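(* Let $\mathcal{A}$ be a unital C*-algebra and let $a\in\mathcal{A}^+$. Then the following conditions are equivalent: (i) $a$ is invertible; (ii) $\|\cdot\|_a$ is equivalent to $\|\cdot\|$ on $\mathcal{A}^*_{\mathrm{h}}$; (iii) for every $\alpha\in\mathbb{R}^+$, $\|\cdot\|_{a^\alpha}$ is equivalent to $\|\cdot\|$ on $\mathcal{A}^*_{\mathrm{h}}$.
   Context: $\mathcal{A}^+$ is the cone of positive elements of the C*-algebra $\mathcal{A}$; $\mathcal{A}^*$ is the Banach dual of $\mathcal{A}$, $\mathcal{A}^*_{\mathrm{h}}$ the real space of Hermitian continuous linear functionals, $\mathcal{A}^*_+$ the cone of positive continuous linear functionals. $\|\cdot\|$ is the usual dual norm on $\mathcal{A}^*_{\mathrm{h}}$. For $b\in\mathcal{A}^+$ the seminorm $r_b$ on $\mathcal{A}^*_{\mathrm{h}}$ is $$r_b(f)=\inf\{f_1(b)+f_2(b)\ :\ f=f_1-f_2,\ f_1,f_2\in\mathcal{A}^*_+\}.$$ When $r_b$ is faithful (i.e. is a norm on $\mathcal{A}^*_{\mathrm{h}}$), it is denoted $\|\cdot\|_b$; an assertion involving $\|\cdot\|_b$ includes the assertion that $r_b$ is a norm. Two norms $p,q$ are equivalent if there are constants $c,C>0$ with $c\,p\le q\le C\,p$. Powers $a^\alpha$ are taken by continuous functional calculus. $\mathbb{R}^+=(0,\infty)$. *)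

theory Defs
  imports "HOL-Analysis.Analysis"
begin

section \<open>Unital C*-algebras\<close>

text \<open>
  The norm is that of the underlying real Banach algebra; \<open>norm 1 = 1\<close> is inherited from
  \<^class>\<open>real_normed_algebra_1\<close>, so the algebra is nonzero.
\<close>

class cstar_algebra = real_normed_algebra_1 + banach +
  fixes scaleC :: "complex \<Rightarrow> 'a \<Rightarrow> 'a"
    and star :: "'a \<Rightarrow> 'a"
  assumes scaleC_add_right: "scaleC c (x + y) = scaleC c x + scaleC c y"
    and scaleC_add_left: "scaleC (c + d) x = scaleC c x + scaleC d x"
    and scaleC_scaleC: "scaleC c (scaleC d x) = scaleC (c * d) x"
    and scaleC_of_real: "scaleC (complex_of_real r) x = scaleR r x"
    and mult_scaleC_left: "scaleC c x * y = scaleC c (x * y)"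
    and mult_scaleC_right: "x * scaleC c y = scaleC c (x * y)"
    and norm_scaleC: "norm (scaleC c x) = cmod c * norm x"
    and star_add: "star (x + y) = star x + star y"
    and star_scaleC: "star (scaleC c x) = scaleC (cnj c) (star x)"
    and star_mult: "star (x * y) = star y * star x"
    and star_star: "star (star x) = x"
    and cstar_identity: "norm (star x * x) = (norm x)\<^sup>2"

instantiation complex :: cstar_algebra
begin

definition scaleC_complex :: "complex \<Rightarrow> complex \<Rightarrow> complex"
  where "scaleC_complex = (*)"

definition star_complex :: "complex \<Rightarrow> complex"
  where "star_complex = cnj"

instance
  by standard
    (simp_all add: scaleC_complex_def star_complex_def algebra_simps norm_mult
      scaleR_conv_of_real power2_eq_square)

end

definition cstar_invertible :: "'a::cstar_algebra \<Rightarrow> bool"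
  where "cstar_invertible x \<longleftrightarrow> (\<exists>y. x * y = 1 \<and> y * x = 1)"

definition cstar_spectrum :: "'a::cstar_algebra \<Rightarrow> complex set"
  where "cstar_spectrum x = {z. \<not> cstar_invertible (scaleC z 1 - x)}"

definition positive_elements :: "'a::cstar_algebra set"
  where "positive_elements =
    {x. star x = x \<and> (\<forall>z \<in> cstar_spectrum x. z \<in> \<real> \<and> 0 \<le> Re z)}"

section \<open>Continuous functional calculus\<close>

text \<open>
  An isometric unital *-homomorphism from the continuous functions on the spectrum of \<open>a\<close>,
  mapping the identity function to \<open>a\<close>. Functions are total, and only their values on the
  spectrum matter: that \<open>\<Phi>\<close> identifies continuous functions agreeing there follows from
  additivity and isometry. The values of \<open>\<Phi>\<close> at other functions are unconstrained.
\<close>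

definition is_functional_calculus ::
  "'a::cstar_algebra \<Rightarrow> ((complex \<Rightarrow> complex) \<Rightarrow> 'a) \<Rightarrow> bool"
  where "is_functional_calculus a \<Phi> \<longleftrightarrow>
    (\<forall>f g. continuous_on (cstar_spectrum a) f \<longrightarrow> continuous_on (cstar_spectrum a) g \<longrightarrow>
        \<Phi> (\<lambda>z. f z + g z) = \<Phi> f + \<Phi> g \<and>
        \<Phi> (\<lambda>z. f z * g z) = \<Phi> f * \<Phi> g) \<and>
    (\<forall>f. continuous_on (cstar_spectrum a) f \<longrightarrow>
        (\<forall>c. \<Phi> (\<lambda>z. c * f z) = scaleC c (\<Phi> f)) \<and>
        \<Phi> (\<lambda>z. cnj (f z)) = star (\<Phi> f) \<and>
        norm (\<Phi> f) = (SUP z \<in> cstar_spectrum a. cmod (f z))) \<and>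
    \<Phi> (\<lambda>z. 1) = 1 \<and>
    \<Phi> (\<lambda>z. z) = a"

text \<open>Intended for normal \<open>a\<close> and \<open>f\<close> continuous on its spectrum.\<close>

definition cfc :: "'a::cstar_algebra \<Rightarrow> (complex \<Rightarrow> complex) \<Rightarrow> 'a"
  where "cfc a f = (THE b. \<exists>\<Phi>. is_functional_calculus a \<Phi> \<and> \<Phi> f = b)"

text \<open>
  The spectrum of a positive element lies in the nonnegative reals, so \<open>Re z\<close> is \<open>z\<close> there;
  for \<open>\<alpha> > 0\<close> the function is continuous at \<open>0\<close>, since \<open>0 powr \<alpha> = 0\<close>.
\<close>

definition cstar_powr :: "'a::cstar_algebra \<Rightarrow> real \<Rightarrow> 'a"
  where "cstar_powr a \<alpha> = cfc a (\<lambda>z. complex_of_real (Re z powr \<alpha>))"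

section \<open>The dual space and the seminorms\<close>

definition cstar_dual :: "('a::cstar_algebra \<Rightarrow> complex) set"
  where "cstar_dual = {f. bounded_linear f \<and> (\<forall>c x. f (scaleC c x) = c * f x)}"

definition hermitian_dual :: "('a::cstar_algebra \<Rightarrow> complex) set"
  where "hermitian_dual = {f \<in> cstar_dual. \<forall>x. f (star x) = cnj (f x)}"

definition positive_dual :: "('a::cstar_algebra \<Rightarrow> complex) set"
  where "positive_dual = {f \<in> cstar_dual. \<forall>x \<in> positive_elements. f x \<in> \<real> \<and> 0 \<le> Re (f x)}"

text \<open>For positive \<open>b\<close> the values \<open>f1 b\<close> and \<open>f2 b\<close> are real, so \<open>Re\<close> is only a coercion.\<close>

definition r_seminorm :: "'a::cstar_algebra \<Rightarrow> ('a \<Rightarrow> complex) \<Rightarrow> real"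
  where "r_seminorm b f =
    Inf {Re (f1 b) + Re (f2 b) | f1 f2.
      f1 \<in> positive_dual \<and> f2 \<in> positive_dual \<and> f = (\<lambda>x. f1 x - f2 x)}"

definition is_norm_on :: "('a \<Rightarrow> complex) set \<Rightarrow> (('a \<Rightarrow> complex) \<Rightarrow> real) \<Rightarrow> bool"
  where "is_norm_on V p \<longleftrightarrow>
    (\<forall>f \<in> V. 0 \<le> p f \<and> (p f = 0 \<longleftrightarrow> f = (\<lambda>x. 0))) \<and>
    (\<forall>f \<in> V. \<forall>t::real. p (\<lambda>x. complex_of_real t * f x) = \<bar>t\<bar> * p f) \<and>
    (\<forall>f \<in> V. \<forall>g \<in> V. p (\<lambda>x. f x + g x) \<le> p f + p g)"

definition equivalent_norms_on ::
  "('a \<Rightarrow> complex) set \<Rightarrow> (('a \<Rightarrow> complex) \<Rightarrow> real) \<Rightarrow> (('a \<Rightarrow> complex) \<Rightarrow> real) \<Rightarrow> bool"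
  where "equivalent_norms_on V p q \<longleftrightarrow>
    is_norm_on V p \<and> is_norm_on V q \<and>
    (\<exists>c>0. \<exists>C>0. \<forall>f \<in> V. c * p f \<le> q f \<and> q f \<le> C * p f)"

end

theory Submission
  imports Defs "HOL-Computational_Algebra.Fundamental_Theorem_Algebra"
begin

text \<open>
  The equivalence of (i) and (ii) compares evaluations of positive functionals. On a positive
  functional the norm is comparable with the value at \<open>1\<close> (lemma
  \<open>positive_dual_onorm_le\<close>), and every Hermitian \<open>f\<close> is a difference of positive functionals
  whose values at \<open>1\<close> are bounded by multiples of \<open>\<parallel>f\<parallel>\<close> (lemma
  \<open>hermitian_dual_decomposition\<close>). So the seminorm \<open>r\<close> at \<open>1\<close> is equivalent to the norm, and if
  \<open>a\<close> is invertible, then \<open>\<epsilon> 1 \<le> a \<le> \<parallel>a\<parallel> 1\<close> for some \<open>\<epsilon> > 0\<close> makes the seminorm at \<open>a\<close>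
  equivalent to the one at \<open>1\<close>. If \<open>a\<close> is not invertible, there is a nonzero positive functional
  vanishing at \<open>a\<close> (lemma \<open>not_invertible_imp_state\<close>), so that the seminorm at \<open>a\<close> is not a
  norm. For (iii), powers of a positive invertible element are positive and invertible, and
  \<open>a\<^sup>1 = a\<close>.

  Two ingredients are developed from first principles. The first is the order on the self-adjoint
  elements. Everything about it rests on the fact that the norm of a self-adjoint element is
  attained on its spectrum (lemma \<open>norm_in_spectrum_selfadjoint\<close>). The proof avoids the spectral
  radius formula and complex analysis: it uses square roots obtained from a contraction, and the
  inequality \<open>\<parallel>u\<parallel>\<^sup>2 \<le> \<parallel>u\<^sup>2 + v\<^sup>2\<parallel>\<close> for commuting self-adjoint \<open>u\<close>, \<open>v\<close>. The positive functionals
  then come from a Hahn--Banach theorem for cones of constraints (lemma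
  \<open>linear_functional_for_cone\<close>), which rests on the linearity of minimal sublinear functions.

  The second is the continuous functional calculus. The spectrum of a self-adjoint element is a
  compact set of reals, where polynomials approximate every continuous function; the spectral
  mapping theorem makes evaluation of polynomials at the element isometric, so it extends to
  limits, and the extension is the only functional calculus.
\<close>

section \<open>Elementary algebra in a C*-algebra\<close>

lemma scaleC_minus_right: "scaleC c (- x) = - scaleC c (x::'a::cstar_algebra)"
proof -
  have "scaleC c 0 = (0::'a)"
    using scaleC_add_right[of c 0 "0::'a"] by simp
  then show ?thesis
    using scaleC_add_right[of c x "- x"] by (simp add: eq_neg_iff_add_eq_0 add.commute)
qed

lemma scaleC_diff_right: "scaleC c (x - y) = scaleC c x - scaleC c (y::'a::cstar_algebra)"
  using scaleC_add_right[of c x "- y"] by (simp add: scaleC_minus_right)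

lemma scaleC_zero_right [simp]: "scaleC c (0::'a::cstar_algebra) = 0"
  using scaleC_diff_right[of c 0 0] by simp

lemma scaleC_zero_left [simp]: "scaleC 0 (x::'a::cstar_algebra) = 0"
  using scaleC_of_real[of 0 x] by simp

lemma scaleC_one [simp]: "scaleC 1 (x::'a::cstar_algebra) = x"
  using scaleC_of_real[of 1 x] by simp

lemma scaleC_minus_left: "scaleC (- c) (x::'a::cstar_algebra) = - scaleC c x"
  using scaleC_add_left[of c "- c" x] by (simp add: eq_neg_iff_add_eq_0 add.commute)

lemma scaleC_diff_left: "scaleC (c - d) (x::'a::cstar_algebra) = scaleC c x - scaleC d x"
  using scaleC_add_left[of c "- d" x] by (simp add: scaleC_minus_left)

lemma scaleC_scaleR: "scaleC c (r *\<^sub>R x) = scaleC (c * complex_of_real r) (x::'a::cstar_algebra)"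
  by (simp add: scaleC_of_real[symmetric] scaleC_scaleC)

lemma scaleR_scaleC: "r *\<^sub>R scaleC c x = scaleC (complex_of_real r * c) (x::'a::cstar_algebra)"
  by (simp add: scaleC_of_real[symmetric] scaleC_scaleC)

lemma star_zero [simp]: "star (0::'a::cstar_algebra) = 0"
  using star_add[of 0 "0::'a"] by simp

lemma star_minus: "star (- x) = - star (x::'a::cstar_algebra)"
  using star_add[of x "- x"] by (simp add: eq_neg_iff_add_eq_0 add.commute)

lemma star_diff: "star (x - y) = star x - star (y::'a::cstar_algebra)"
  using star_add[of x "- y"] by (simp add: star_minus)

lemma star_one [simp]: "star (1::'a::cstar_algebra) = 1"
  using star_mult[of "star 1" "1::'a"] by (simp add: star_star)

lemma star_scaleR: "star (r *\<^sub>R x) = r *\<^sub>R star (x::'a::cstar_algebra)"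
  using star_scaleC[of "complex_of_real r" x] by (simp add: scaleC_of_real)

lemma norm_star [simp]: "norm (star x) = norm (x::'a::cstar_algebra)"
proof -
  have le: "norm y \<le> norm (star y)" for y :: 'a
  proof (cases "y = 0")
    case False
    have "norm y * norm y \<le> norm (star y) * norm y"
      using norm_mult_ineq[of "star y" y] by (simp add: cstar_identity power2_eq_square)
    then show ?thesis using False by simp
  qed simp
  show ?thesis
    using le[of x] le[of "star x"] by (simp add: star_star)
qed

lemma norm_square_selfadjoint:
  fixes x :: "'a::cstar_algebra"
  assumes "star x = x"
  shows "norm (x * x) = (norm x)\<^sup>2"
  using cstar_identity[of x] assms by simp

lemma bounded_linear_star: "bounded_linear (star :: 'a::cstar_algebra \<Rightarrow> 'a)"
  by (rule bounded_linear_intro[where K = 1]) (simp_all add: star_add star_scaleR)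

section \<open>Invertibility and the spectrum\<close>

lemma invertible_mult:
  fixes x y :: "'a::cstar_algebra"
  assumes "cstar_invertible x" "cstar_invertible y"
  shows "cstar_invertible (x * y)"
proof -
  obtain x' y' where *: "x * x' = 1" "x' * x = 1" "y * y' = 1" "y' * y = 1"
    using assms unfolding cstar_invertible_def by blast
  have "(x * y) * (y' * x') = x * (y * y') * x'" "(y' * x') * (x * y) = y' * (x' * x) * y"
    by (simp_all only: mult.assoc)
  with * show ?thesis
    unfolding cstar_invertible_def by (intro exI[of _ "y' * x'"]) simp
qed

text \<open>
  An inverse \<open>w\<close> of \<open>x y\<close> gives the right inverse \<open>y w\<close> of \<open>x\<close>, and, because \<open>x\<close> and \<open>y\<close> commute,
  also the left inverse \<open>w y\<close>.
\<close>

lemma invertible_factor: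
  fixes x y :: "'a::cstar_algebra"
  assumes "x * y = y * x" "cstar_invertible (x * y)"
  shows "cstar_invertible x"
proof -
  obtain w where w: "x * y * w = 1" "w * (x * y) = 1"
    using assms unfolding cstar_invertible_def by blast
  have left: "(w * y) * x = 1" using w(2) assms(1) by (simp add: mult.assoc)
  have right: "x * (y * w) = 1" using w(1) by (simp add: mult.assoc)
  have "w * y = (w * y) * (x * (y * w))" using right by simp
  also have "\<dots> = y * w" using left by (metis mult.assoc mult_1_left)
  finally show ?thesis using left right unfolding cstar_invertible_def by metis
qed

lemma not_invertible_zero: "\<not> cstar_invertible (0::'a::cstar_algebra)"
  unfolding cstar_invertible_def by simp

lemma invertible_scaleC:
  fixes x :: "'a::cstar_algebra"
  assumes "c \<noteq> 0"
  shows "cstar_invertible (scaleC c x) \<longleftrightarrow> cstar_invertible x"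
proof -
  have *: "cstar_invertible (scaleC d y)" if d: "d \<noteq> 0" and y: "cstar_invertible y" for d and y :: 'a
  proof -
    obtain w where "y * w = 1" "w * y = 1" using y unfolding cstar_invertible_def by blast
    with d show ?thesis
      unfolding cstar_invertible_def
      by (intro exI[of _ "scaleC (1/d) w"])
        (simp add: mult_scaleC_left mult_scaleC_right scaleC_scaleC)
  qed
  show ?thesis
    using *[of c x] *[of "1/c" "scaleC c x"] assms by (auto simp: scaleC_scaleC)
qed

lemma invertible_minus: "cstar_invertible (- x) \<longleftrightarrow> cstar_invertible (x::'a::cstar_algebra)"
  using invertible_scaleC[of "-1" x] by (simp add: scaleC_minus_left)

text \<open>The Neumann series.\<close>

lemma invertible_one_minus:
  fixes x :: "'a::cstar_algebra"
  assumes "norm x < 1"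
  shows "cstar_invertible (1 - x)"
proof -
  let ?s = "\<Sum>i. x ^ i"
  have "(\<lambda>i. x ^ i) sums ?s"
    using complete_algebra_summable_geometric[OF assms] by (rule summable_sums)
  then have lim: "(\<lambda>n. \<Sum>i<n. x ^ i) \<longlonglongrightarrow> ?s"
    by (simp add: sums_def)
  have left: "(1 - x) * (\<Sum>i<n. x ^ i) = 1 - x ^ n" for n
    by (induction n) (simp_all add: distrib_left, simp add: algebra_simps)
  have right: "(\<Sum>i<n. x ^ i) * (1 - x) = 1 - x ^ n" for n
    by (induction n) (simp_all add: distrib_right, simp add: algebra_simps power_commutes)
  have "(\<lambda>n. x ^ n) \<longlonglongrightarrow> 0"
    using assms by (rule LIMSEQ_power_zero)
  then have one: "(\<lambda>n. 1 - x ^ n) \<longlonglongrightarrow> 1"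
    using tendsto_diff[OF tendsto_const, of "\<lambda>n. x ^ n" 0 sequentially 1] by simp
  have "(1 - x) * ?s = 1"
    using LIMSEQ_unique[OF tendsto_mult_left[OF lim, of "1 - x"]] one by (simp add: left)
  moreover have "?s * (1 - x) = 1"
    using LIMSEQ_unique[OF tendsto_mult_right[OF lim, of "1 - x"]] one by (simp add: right)
  ultimately show ?thesis unfolding cstar_invertible_def by blast
qed

lemma spectrum_iff: "z \<in> cstar_spectrum x \<longleftrightarrow> \<not> cstar_invertible (scaleC z 1 - x)"
  by (simp add: cstar_spectrum_def)

lemma spectrum_norm_le:
  fixes x :: "'a::cstar_algebra"
  assumes "z \<in> cstar_spectrum x"
  shows "cmod z \<le> norm x"
proof (rule ccontr)
  assume "\<not> cmod z \<le> norm x"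
  then have z: "norm x < cmod z" "z \<noteq> 0" by (auto simp: not_le)
  have "norm (scaleC (1/z) x) < 1"
    using z by (simp add: norm_scaleC norm_divide field_simps)
  then have "cstar_invertible (scaleC z (1 - scaleC (1/z) x))"
    using invertible_one_minus invertible_scaleC[OF z(2)] by blast
  also have "scaleC z (1 - scaleC (1/z) x) = scaleC z 1 - x"
    using z(2) by (simp add: scaleC_diff_right scaleC_scaleC)
  finally show False using assms by (simp add: spectrum_iff)
qed

lemma spectrum_scaleC_one_minus:
  "z \<in> cstar_spectrum (scaleC w 1 - x) \<longleftrightarrow> w - z \<in> cstar_spectrum (x::'a::cstar_algebra)"
proof -
  have "scaleC z 1 - (scaleC w 1 - x) = - (scaleC (w - z) 1 - x)"
    by (simp add: scaleC_diff_left)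
  then show ?thesis by (simp only: spectrum_iff invertible_minus)
qed

lemma spectrum_minus: "z \<in> cstar_spectrum (- x) \<longleftrightarrow> - z \<in> cstar_spectrum (x::'a::cstar_algebra)"
  using spectrum_scaleC_one_minus[of z 0 x] by simp

lemma spectrum_add_scaleC_one:
  "z \<in> cstar_spectrum (x + scaleC w 1) \<longleftrightarrow> z - w \<in> cstar_spectrum (x::'a::cstar_algebra)"
  using spectrum_scaleC_one_minus[of z w "- x"] spectrum_minus[of "w - z" x]
  by (simp add: add.commute)

lemma zero_in_spectrum: "0 \<in> cstar_spectrum x \<longleftrightarrow> \<not> cstar_invertible (x::'a::cstar_algebra)"
  by (simp add: spectrum_iff invertible_minus)

text \<open>
  Shifting along the imaginary axis turns the crude bound of the spectrum by the norm into
  reality of the spectrum: if \<open>s + \<i>t\<close> is in the spectrum of a self-adjoint \<open>x\<close>, then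
  \<open>s + \<i>(t + r)\<close> is in that of \<open>x + \<i>r\<close>, whose norm squared is at most \<open>\<parallel>x\<parallel>\<^sup>2 + r\<^sup>2\<close> by the
  C*-identity, and this is violated by a suitable real \<open>r\<close> unless \<open>t = 0\<close>.
\<close>

lemma spectrum_selfadjoint_real:
  fixes x :: "'a::cstar_algebra"
  assumes x: "star x = x" and z: "z \<in> cstar_spectrum x"
  shows "z \<in> \<real>"
proof (rule ccontr)
  assume "z \<notin> \<real>"
  then have t: "Im z \<noteq> 0" by (simp add: complex_is_Real_iff)
  define r where "r = ((norm x)\<^sup>2 + 1) / (2 * Im z)"
  let ?c = "complex_of_real r * \<i>"
  let ?y = "x + scaleC ?c 1"
  have "z + ?c \<in> cstar_spectrum ?y"
    using z by (simp add: spectrum_add_scaleC_one)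
  then have "(cmod (z + ?c))\<^sup>2 \<le> (norm ?y)\<^sup>2"
    by (intro power_mono spectrum_norm_le) simp_all
  also have "\<dots> = norm (star ?y * ?y)" by (simp add: cstar_identity)
  also have "star ?y * ?y = x * x + (r\<^sup>2) *\<^sub>R 1"
    using x by (simp add: star_add star_scaleC algebra_simps mult_scaleC_left mult_scaleC_right
        scaleC_scaleC scaleC_minus_left scaleC_diff_right power2_eq_square flip: scaleC_of_real)
  also have "norm \<dots> \<le> norm (x * x) + norm ((r\<^sup>2) *\<^sub>R (1::'a))" by (rule norm_triangle_ineq)
  also have "\<dots> = (norm x)\<^sup>2 + r\<^sup>2" using norm_square_selfadjoint[OF x] by simp
  finally have "(Re z)\<^sup>2 + (Im z + r)\<^sup>2 \<le> (norm x)\<^sup>2 + r\<^sup>2"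
    by (simp add: cmod_power2)
  then have "(Re z)\<^sup>2 + (Im z)\<^sup>2 + 2 * Im z * r \<le> (norm x)\<^sup>2"
    by (simp add: power2_sum)
  moreover have "2 * Im z * r = (norm x)\<^sup>2 + 1"
    using t by (simp add: r_def)
  ultimately show False
    using zero_le_power2[of "Re z"] zero_le_power2[of "Im z"] by linarith
qed

lemma compact_spectrum: "compact (cstar_spectrum (x::'a::cstar_algebra))"
proof -
  have "open (- cstar_spectrum x)"
    unfolding open_dist
  proof
    fix z assume "z \<in> - cstar_spectrum x"
    then have "cstar_invertible (scaleC z 1 - x)" by (simp add: spectrum_iff)
    then obtain u where u: "(scaleC z 1 - x) * u = 1" "u * (scaleC z 1 - x) = 1"
      unfolding cstar_invertible_def by blast
    have pos: "norm u > 0" using u by (metis mult_zero_left norm_le_zero_iff not_le zero_neq_one)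
    have "w \<in> - cstar_spectrum x" if "dist w z < 1 / norm u" for w
    proof -
      have "norm (scaleC (z - w) u) < 1"
        using that pos by (simp add: norm_scaleC dist_norm norm_minus_commute field_simps)
      then have "cstar_invertible ((scaleC z 1 - x) * (1 - scaleC (z - w) u))"
        using \<open>cstar_invertible (scaleC z 1 - x)\<close>
        by (intro invertible_mult invertible_one_minus)
      also have "(scaleC z 1 - x) * (1 - scaleC (z - w) u) = scaleC w 1 - x"
        using u(1) by (simp only: right_diff_distrib mult_scaleC_right)
          (simp add: scaleC_diff_left)
      finally show ?thesis by (simp add: spectrum_iff)
    qed
    then show "\<exists>e>0. \<forall>y. dist y z < e \<longrightarrow> y \<in> - cstar_spectrum x"
      using pos by (intro exI[of _ "1 / norm u"]) simp
  qed
  then have "closed (cstar_spectrum x)" by (simp add: closed_def)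
  moreover have "bounded (cstar_spectrum x)"
    using spectrum_norm_le by (auto simp: bounded_iff)
  ultimately show ?thesis by (simp add: compact_eq_bounded_closed)
qed

section \<open>The norm of a self-adjoint element is attained on its spectrum\<close>

text \<open>
  With \<open>w = u + \<i> v\<close>, commutation gives \<open>w\<^sup>* w = u\<^sup>2 + v\<^sup>2\<close>, and \<open>u\<close> is the mean of \<open>w\<close> and \<open>w\<^sup>*\<close>,
  so \<open>\<parallel>u\<parallel> \<le> \<parallel>w\<parallel>\<close>.
\<close>

lemma commute_norm_square_le:
  fixes u v :: "'a::cstar_algebra"
  assumes u: "star u = u" and v: "star v = v" and uv: "u * v = v * u"
  shows "(norm u)\<^sup>2 \<le> norm (u * u + v * v)"
proof -
  define w where "w = u + scaleC \<i> v"
  have sw: "star w = u - scaleC \<i> v"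
    using u v by (simp add: w_def star_add star_scaleC scaleC_minus_left)
  have "star w * w = u * u + v * v"
    unfolding sw unfolding w_def
    using uv by (simp add: algebra_simps mult_scaleC_left mult_scaleC_right scaleC_scaleC
        scaleC_minus_left scaleC_diff_right)
  then have *: "(norm w)\<^sup>2 = norm (u * u + v * v)"
    using cstar_identity[of w] by simp
  have "2 *\<^sub>R u = w + star w" by (simp add: sw) (simp add: w_def scaleR_2)
  then have "2 * norm u \<le> norm w + norm (star w)"
    using norm_triangle_ineq[of w "star w"] by (metis norm_scaleR abs_numeral)
  then have "norm u \<le> norm w" by simp
  then show ?thesis using * by (metis power_mono norm_ge_zero)
qed

text \<open>
  A square root of \<open>c - x\<close> for \<open>\<parallel>x\<parallel> < c\<close>: after rescaling to \<open>c = 1\<close>, the equation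
  \<open>(1 - p)\<^sup>2 = 1 - x\<close> reads \<open>p = (x + p\<^sup>2) / 2\<close>, and the right-hand side is a contraction of the
  ball of radius \<open>\<parallel>x\<parallel>\<close>. Iterating inside the closed set of self-adjoint elements commuting with
  the commutant of \<open>x\<close> keeps both properties.
\<close>

lemma sqrt_one_minus:
  fixes x :: "'a::cstar_algebra"
  assumes x: "star x = x" and n: "norm x < 1"
  obtains q where "star q = q" "\<And>z. z * x = x * z \<Longrightarrow> z * q = q * z" "q * q = 1 - x"
proof -
  define S where "S = {p. star p = p \<and> norm p \<le> norm x \<and> (\<forall>z. z * x = x * z \<longrightarrow> z * p = p * z)}"
  define F where "F p = (1/2) *\<^sub>R (x + p * p)" for p
  have cstar: "continuous_on UNIV (star :: 'a \<Rightarrow> 'a)"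
    by (rule linear_continuous_on[OF bounded_linear_star])
  have "closed S"
    unfolding S_def
    by (intro closed_Collect_conj closed_Collect_all closed_Collect_imp closed_Collect_eq
        closed_Collect_le continuous_intros cstar open_Collect_const)
  then have "complete S" by (simp add: complete_eq_closed)
  moreover have "0 \<in> S" by (simp add: S_def)
  moreover have "F ` S \<subseteq> S"
  proof safe
    fix p assume "p \<in> S"
    then have p: "star p = p" "norm p \<le> norm x" "\<And>z. z * x = x * z \<Longrightarrow> z * p = p * z"
      by (auto simp: S_def)
    have "norm p * norm p \<le> norm x * 1"
      using p(2) n by (intro mult_mono) auto
    then have "norm (x + p * p) \<le> norm x + norm x"
      using norm_triangle_ineq[of x "p * p"] norm_mult_ineq[of p p] by linarith
    then have "norm (F p) \<le> norm x" by (simp add: F_def)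
    moreover have "z * F p = F p * z" if "z * x = x * z" for z
    proof -
      have "z * (p * p) = (p * p) * z" using p(3)[OF that] by (metis mult.assoc)
      then show ?thesis using that by (simp add: F_def algebra_simps)
    qed
    ultimately show "F p \<in> S"
      using x p(1) by (simp add: S_def F_def star_scaleR star_add star_mult)
  qed
  moreover have "dist (F p) (F q) \<le> norm x * dist p q" if "p \<in> S" "q \<in> S" for p q
  proof -
    have eq: "F p - F q = (1/2) *\<^sub>R (p * (p - q) + (p - q) * q)"
      by (simp add: F_def algebra_simps)
    have "norm (p * (p - q) + (p - q) * q) \<le> norm p * norm (p - q) + norm (p - q) * norm q"
      by (intro norm_triangle_le add_mono norm_mult_ineq)
    also have "\<dots> \<le> norm x * norm (p - q) + norm (p - q) * norm x"
      using that by (intro add_mono mult_mono) (auto simp: S_def)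
    finally show ?thesis by (simp add: dist_norm eq)
  qed
  ultimately obtain p where p: "p \<in> S" "F p = p"
    using Banach_fix[of S "norm x" F] n by auto
  have "2 *\<^sub>R p = 2 *\<^sub>R F p" using p(2) by simp
  then have "x + p * p = p + p" by (simp add: F_def scaleR_2)
  then have "(1 - p) * (1 - p) = 1 - x" by (simp add: algebra_simps)
  moreover have "star (1 - p) = 1 - p" "z * (1 - p) = (1 - p) * z" if "z * x = x * z" for z
    using p(1) that by (auto simp: S_def star_diff algebra_simps)
  ultimately show thesis
    using that[of "1 - p"] by metis
qed

lemma sqrt_scaleR_one_minus:
  fixes x :: "'a::cstar_algebra"
  assumes x: "star x = x" and n: "norm x < c"
  obtains q where "star q = q" "\<And>z. z * x = x * z \<Longrightarrow> z * q = q * z" "q * q = c *\<^sub>R 1 - x"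
proof -
  have c: "c > 0" using n norm_ge_zero[of x] by linarith
  have "star ((1/c) *\<^sub>R x) = (1/c) *\<^sub>R x" "norm ((1/c) *\<^sub>R x) < 1"
    using x n c by (simp_all add: star_scaleR)
  from sqrt_one_minus[OF this]
  obtain q where q: "star q = q" "\<And>z. z * ((1/c) *\<^sub>R x) = ((1/c) *\<^sub>R x) * z \<Longrightarrow> z * q = q * z"
      "q * q = 1 - (1/c) *\<^sub>R x"
    by blast
  show thesis
  proof (rule that[of "sqrt c *\<^sub>R q"])
    show "star (sqrt c *\<^sub>R q) = sqrt c *\<^sub>R q" using q(1) by (simp add: star_scaleR)
    show "z * (sqrt c *\<^sub>R q) = sqrt c *\<^sub>R q * z" if "z * x = x * z" for z
      using q(2)[of z] that by (simp only: mult_scaleR_right mult_scaleR_left)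
    show "sqrt c *\<^sub>R q * sqrt c *\<^sub>R q = c *\<^sub>R 1 - x"
      using c q(3) by (simp add: scaleR_diff_right)
  qed
qed

text \<open>
  If neither \<open>N = \<parallel>y\<parallel>\<close> nor \<open>-N\<close> were in the spectrum, \<open>h = N\<^sup>2 - y\<^sup>2\<close> would be invertible. Then for
  small \<open>\<epsilon>\<close> the element \<open>h\<close> is, up to second order, at least \<open>\<epsilon>\<close>: both \<open>h + \<epsilon>\<close> and
  \<open>1 - 2\<epsilon>h\<^sup>-\<^sup>1\<close> have self-adjoint square roots, and the product of these two elements is
  \<open>h - \<epsilon> - 2\<epsilon>\<^sup>2h\<^sup>-\<^sup>1\<close>. So \<open>y\<^sup>2\<close> plus a square equals \<open>N\<^sup>2 - \<epsilon> - 2\<epsilon>\<^sup>2h\<^sup>-\<^sup>1\<close>, which has norm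
  less than \<open>N\<^sup>2\<close>; but adding a commuting square cannot decrease the norm.
\<close>

lemma norm_in_spectrum_selfadjoint:
  fixes y :: "'a::cstar_algebra"
  assumes y: "star y = y"
  shows "complex_of_real (norm y) \<in> cstar_spectrum y \<or> - complex_of_real (norm y) \<in> cstar_spectrum y"
proof (rule ccontr)
  define N where "N = norm y"
  assume "\<not> ?thesis"
  then have "cstar_invertible (N *\<^sub>R 1 - y)" "cstar_invertible (- (- (N *\<^sub>R 1) - y))"
    by (auto simp: spectrum_iff N_def scaleC_of_real scaleC_minus_left invertible_minus
        simp del: minus_diff_eq)
  then have "cstar_invertible ((N *\<^sub>R 1 - y) * (- (- (N *\<^sub>R 1) - y)))"
    by (rule invertible_mult)
  also have "(N *\<^sub>R 1 - y) * (- (- (N *\<^sub>R 1) - y)) = (N\<^sup>2) *\<^sub>R 1 - y * y"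
    by (simp add: algebra_simps power2_eq_square)
  finally have inv: "cstar_invertible ((N\<^sup>2) *\<^sub>R 1 - y * y)" .
  define h where "h = (N\<^sup>2) *\<^sub>R 1 - y * y"
  obtain k where k: "h * k = 1" "k * h = 1"
    using inv unfolding h_def cstar_invertible_def by blast
  have Npos: "N > 0"
    using inv not_invertible_zero by (cases "y = 0") (auto simp: N_def)
  have sh: "star h = h" by (simp add: h_def star_diff star_scaleR star_mult y)
  have sk: "star k = k"
  proof -
    have "star k * h = 1" using k(1) sh by (metis star_mult star_one)
    then have "star k * h * k = k" by simp
    then show ?thesis using k(1) by (simp add: mult.assoc)
  qed
  have commk: "z * k = k * z" if "z * h = h * z" for z
  proof -
    have "k * (z * h) * k = k * (h * z) * k" using that by simp
    then have "(k * z) * (h * k) = (k * h) * (z * k)" by (simp only: mult.assoc)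
    then show ?thesis using k by simp
  qed
  \<comment> \<open>small enough for \<open>1 - 2 e k\<close> to have a square root, for the second-order term to be below
    \<open>e\<close>, and for \<open>N\<^sup>2 - e\<close> not to be negative\<close>
  define e where "e = min (N\<^sup>2) (1 / (4 * norm k + 1))"
  have den: "4 * norm k + 1 > 0" using norm_ge_zero[of k] by linarith
  have e: "e > 0" "e \<le> N\<^sup>2" using Npos den by (auto simp: e_def)
  have "e * (4 * norm k + 1) \<le> 1"
    using den by (simp add: e_def min_def field_simps)
  then have "2 * (2 * e * norm k) < 2"
    using e(1) by (simp add: algebra_simps)
  then have ek: "2 * e * norm k < 1" by simp
  have nyy: "norm (y * y) = N\<^sup>2" using norm_square_selfadjoint[OF y] by (simp add: N_def)
  have "star (y * y) = y * y" "norm (y * y) < N\<^sup>2 + e"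
    using nyy e y by (simp_all only: star_mult less_add_same_cancel1)
  from sqrt_scaleR_one_minus[OF this]
  obtain q where q: "star q = q" "\<And>z. z * (y * y) = (y * y) * z \<Longrightarrow> z * q = q * z"
      "q * q = (N\<^sup>2 + e) *\<^sub>R 1 - y * y"
    by blast
  have "star ((2 * e) *\<^sub>R k) = (2 * e) *\<^sub>R k" "norm ((2 * e) *\<^sub>R k) < 1"
    using ek e sk by (simp_all add: star_scaleR)
  from sqrt_one_minus[OF this]
  obtain p where p: "star p = p" "\<And>z. z * ((2 * e) *\<^sub>R k) = ((2 * e) *\<^sub>R k) * z \<Longrightarrow> z * p = p * z"
      "p * p = 1 - (2 * e) *\<^sub>R k"
    by blast
  have yh: "y * h = h * y" by (simp add: h_def algebra_simps)
  have kyy: "k * (y * y) = (y * y) * k"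
    using commk[OF yh] by (metis mult.assoc)
  have qk: "q * k = k * q" using q(2)[OF kyy] by simp
  have qp: "q * p = p * q" using p(2)[of q] qk by simp
  have yq: "y * q = q * y" using q(2)[of y] by (simp add: mult.assoc)
  have yp: "y * p = p * y" using p(2)[of y] commk[OF yh] by simp
  define w where "w = q * p"
  have sw: "star w = w" using q(1) p(1) qp by (simp add: w_def star_mult)
  have yw: "y * w = w * y" unfolding w_def using yq yp by (metis mult.assoc)
  have "w * w = (q * q) * (p * p)" unfolding w_def using qp by (metis mult.assoc)
  also have "\<dots> = (h + e *\<^sub>R 1) * (1 - (2 * e) *\<^sub>R k)"
    by (simp add: q(3) p(3) h_def algebra_simps)
  also have "\<dots> = h - e *\<^sub>R 1 - (2 * e\<^sup>2) *\<^sub>R k"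
    by (simp add: algebra_simps k power2_eq_square scaleR_2 flip: scaleR_left_distrib)
  finally have "y * y + w * w = (N\<^sup>2 - e) *\<^sub>R 1 - (2 * e\<^sup>2) *\<^sub>R k"
    by (simp add: h_def algebra_simps)
  then have "N\<^sup>2 \<le> norm ((N\<^sup>2 - e) *\<^sub>R 1 - (2 * e\<^sup>2) *\<^sub>R k)"
    using commute_norm_square_le[OF y sw yw] by (simp add: N_def)
  also have "\<dots> \<le> norm ((N\<^sup>2 - e) *\<^sub>R (1::'a)) + norm ((2 * e\<^sup>2) *\<^sub>R k)"
    by (rule norm_triangle_ineq4)
  also have "\<dots> = N\<^sup>2 - e + e * (2 * e * norm k)"
    using e by (simp add: power2_eq_square)
  also have "\<dots> < N\<^sup>2 - e + e * 1"
    using ek e by (intro add_strict_left_mono mult_strict_left_mono) auto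
  finally show False by simp
qed

section \<open>The order given by the positive cone\<close>

lemma spectrum_scaleR_one_minus:
  fixes x :: "'a::cstar_algebra"
  shows "complex_of_real r \<in> cstar_spectrum (c *\<^sub>R 1 - x) \<longleftrightarrow> complex_of_real (c - r) \<in> cstar_spectrum x"
  using spectrum_scaleC_one_minus[of "complex_of_real r" "complex_of_real c" x]
  by (simp add: scaleC_of_real)

lemma positive_elements_iff:
  fixes x :: "'a::cstar_algebra"
  shows "x \<in> positive_elements \<longleftrightarrow>
    star x = x \<and> (\<forall>r. complex_of_real r \<in> cstar_spectrum x \<longrightarrow> 0 \<le> r)"
proof
  assume "star x = x \<and> (\<forall>r. complex_of_real r \<in> cstar_spectrum x \<longrightarrow> 0 \<le> r)"
  then show "x \<in> positive_elements"
    unfolding positive_elements_def using spectrum_selfadjoint_real[of x]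
    by (auto elim!: Reals_cases)
qed (auto simp: positive_elements_def)

lemma positive_spectrum:
  "x \<in> positive_elements \<Longrightarrow> complex_of_real r \<in> cstar_spectrum x \<Longrightarrow> 0 \<le> r"
  by (simp add: positive_elements_iff)

lemma positive_selfadjoint: "x \<in> positive_elements \<Longrightarrow> star x = (x::'a::cstar_algebra)"
  by (simp add: positive_elements_iff)

lemma norm_le_selfadjoint:
  fixes x :: "'a::cstar_algebra"
  assumes "star x = x" "\<And>r. complex_of_real r \<in> cstar_spectrum x \<Longrightarrow> \<bar>r\<bar> \<le> c"
  shows "norm x \<le> c"
  using norm_in_spectrum_selfadjoint[OF assms(1)] assms(2)[of "norm x"] assms(2)[of "- norm x"]
  by auto

lemma spectrum_real_bound:
  "complex_of_real r \<in> cstar_spectrum x \<Longrightarrow> \<bar>r\<bar> \<le> norm (x::'a::cstar_algebra)"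
  using spectrum_norm_le[of "complex_of_real r" x] by simp

lemma positive_norm_minus:
  fixes x :: "'a::cstar_algebra"
  assumes "star x = x" "norm x \<le> c"
  shows "c *\<^sub>R 1 - x \<in> positive_elements"
  unfolding positive_elements_iff
proof (intro conjI allI impI)
  fix r assume "complex_of_real r \<in> cstar_spectrum (c *\<^sub>R 1 - x)"
  then have "\<bar>c - r\<bar> \<le> norm x"
    by (intro spectrum_real_bound) (simp only: spectrum_scaleR_one_minus)
  then show "0 \<le> r" using assms(2) by linarith
qed (use assms in \<open>simp add: star_diff star_scaleR\<close>)

text \<open>
  The spectrum of a self-adjoint \<open>x\<close> with \<open>\<parallel>x\<parallel> \<le> c\<close> lies in \<open>[-c, c]\<close>, where \<open>r \<ge> 0\<close> means
  \<open>\<bar>c - r\<bar> \<le> c\<close>. Positivity becomes a condition on norms, from which stability of the cone under sums is the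
  triangle inequality.
\<close>

lemma positive_iff_norm:
  fixes x :: "'a::cstar_algebra"
  assumes "star x = x" "norm x \<le> c"
  shows "x \<in> positive_elements \<longleftrightarrow> norm (c *\<^sub>R 1 - x) \<le> c"
proof
  assume x: "x \<in> positive_elements"
  show "norm (c *\<^sub>R 1 - x) \<le> c"
  proof (rule norm_le_selfadjoint)
    fix r assume "complex_of_real r \<in> cstar_spectrum (c *\<^sub>R 1 - x)"
    then have "complex_of_real (c - r) \<in> cstar_spectrum x" by (simp only: spectrum_scaleR_one_minus)
    then show "\<bar>r\<bar> \<le> c"
      using positive_spectrum[OF x, of "c - r"] spectrum_real_bound[of "c - r" x] assms(2) by linarith
  qed (use assms in \<open>simp add: star_diff star_scaleR\<close>)
next
  assume n: "norm (c *\<^sub>R 1 - x) \<le> c"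
  have "0 \<le> r" if "complex_of_real r \<in> cstar_spectrum x" for r
    using that n spectrum_real_bound[of "c - r" "c *\<^sub>R 1 - x"]
    by (simp add: spectrum_scaleR_one_minus del: of_real_diff)
  then show "x \<in> positive_elements" using assms by (simp add: positive_elements_iff)
qed

lemma positive_add:
  fixes x y :: "'a::cstar_algebra"
  assumes x: "x \<in> positive_elements" and y: "y \<in> positive_elements"
  shows "x + y \<in> positive_elements"
proof -
  have sx: "star x = x" and sy: "star y = y" using x y by (simp_all add: positive_selfadjoint)
  have "norm ((norm x + norm y) *\<^sub>R 1 - (x + y)) =
      norm ((norm x *\<^sub>R 1 - x) + (norm y *\<^sub>R 1 - y))"
    by (simp add: algebra_simps)
  also have "\<dots> \<le> norm (norm x *\<^sub>R 1 - x) + norm (norm y *\<^sub>R 1 - y)"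
    by (rule norm_triangle_ineq)
  also have "\<dots> \<le> norm x + norm y"
    using positive_iff_norm[OF sx order_refl] positive_iff_norm[OF sy order_refl] x y
    by (intro add_mono) auto
  finally show ?thesis
    using positive_iff_norm[of "x + y" "norm x + norm y"] sx sy norm_triangle_ineq[of x y]
    by (simp add: star_add)
qed

lemma positive_zero: "0 \<in> (positive_elements :: 'a::cstar_algebra set)"
  using spectrum_real_bound[of _ "0::'a"] by (force simp: positive_elements_iff)

lemma positive_scaleR:
  fixes x :: "'a::cstar_algebra"
  assumes x: "x \<in> positive_elements" and r: "0 \<le> r"
  shows "r *\<^sub>R x \<in> positive_elements"
proof -
  have "norm ((r * norm x) *\<^sub>R 1 - r *\<^sub>R x) = r * norm (norm x *\<^sub>R 1 - x)"
    using r norm_scaleR[of r "norm x *\<^sub>R 1 - x"] by (simp add: scaleR_diff_right)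
  also have "\<dots> \<le> r * norm x"
    using positive_iff_norm[of x "norm x"] x r positive_selfadjoint by (intro mult_left_mono) auto
  finally show ?thesis
    using positive_iff_norm[of "r *\<^sub>R x" "r * norm x"] x r
    by (simp add: star_scaleR positive_selfadjoint)
qed

lemma positive_norm_le:
  fixes y :: "'a::cstar_algebra"
  assumes y: "y \<in> positive_elements" and c: "c *\<^sub>R 1 - y \<in> positive_elements"
  shows "norm y \<le> c"
proof (rule norm_le_selfadjoint)
  fix r assume r: "complex_of_real r \<in> cstar_spectrum y"
  then have "complex_of_real (c - r) \<in> cstar_spectrum (c *\<^sub>R 1 - y)"
    by (simp add: spectrum_scaleR_one_minus del: of_real_diff)
  then show "\<bar>r\<bar> \<le> c" using positive_spectrum[OF y r] positive_spectrum[OF c, of "c - r"] by linarith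
qed (rule positive_selfadjoint[OF y])

lemma positive_one: "1 \<in> (positive_elements :: 'a::cstar_algebra set)"
  using positive_norm_minus[of "0::'a" 1] by simp

text \<open>For \<open>r = - s\<^sup>2 < 0\<close>, \<open>r 1 - x\<^sup>2\<close> factors into \<open>\<plusminus>\<i> s 1 - x\<close>, which are invertible.\<close>

lemma positive_square:
  fixes x :: "'a::cstar_algebra"
  assumes x: "star x = x"
  shows "x * x \<in> positive_elements"
proof -
  have "0 \<le> r" if r: "complex_of_real r \<in> cstar_spectrum (x * x)" for r
  proof (rule ccontr)
    assume "\<not> 0 \<le> r"
    define s where "s = sqrt (- r)"
    have s: "s * s = - r" "s \<noteq> 0" using \<open>\<not> 0 \<le> r\<close> by (simp_all add: s_def)
    have nonreal: "cstar_invertible (scaleC z 1 - x)" if "Im z \<noteq> 0" for z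
      using spectrum_selfadjoint_real[OF x, of z] that
      by (auto simp: spectrum_iff complex_is_Real_iff)
    have "cstar_invertible ((scaleC (\<i> * s) 1 - x) * (scaleC (- (\<i> * s)) 1 - x))"
      using s(2) by (intro invertible_mult nonreal) auto
    also have "(scaleC (\<i> * s) 1 - x) * (scaleC (- (\<i> * s)) 1 - x) = - (scaleC (complex_of_real r) 1 - x * x)"
      using s(1) by (simp add: algebra_simps mult_scaleC_left mult_scaleC_right scaleC_scaleC
          scaleC_minus_left scaleC_diff_right scaleC_minus_right flip: of_real_mult)
    finally show False using r by (simp add: invertible_minus spectrum_iff del: minus_diff_eq)
  qed
  then show ?thesis using x by (simp add: positive_elements_iff star_mult)
qed

lemma positive_invertible_ge:
  fixes a :: "'a::cstar_algebra"
  assumes a: "a \<in> positive_elements" and inv: "cstar_invertible a"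
  obtains e where "e > 0" "a - e *\<^sub>R 1 \<in> positive_elements"
proof -
  have "open (- cstar_spectrum a)" "0 \<in> - cstar_spectrum a"
    using compact_imp_closed[OF compact_spectrum[of a]] inv by (auto simp: zero_in_spectrum)
  then obtain e where e: "e > 0" "ball 0 e \<subseteq> - cstar_spectrum a"
    using open_contains_ball by blast
  have "0 \<le> r" if "complex_of_real r \<in> cstar_spectrum (a - e *\<^sub>R 1)" for r
  proof -
    have "a - e *\<^sub>R 1 = a + scaleC (complex_of_real (- e)) 1"
      by (simp only: scaleC_of_real) simp
    then have "complex_of_real r - complex_of_real (- e) \<in> cstar_spectrum a"
      using that by (simp only: spectrum_add_scaleC_one)
    then have *: "complex_of_real (r + e) \<in> cstar_spectrum a" by simp
    then have "0 \<le> r + e" by (rule positive_spectrum[OF a])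
    moreover have "complex_of_real (r + e) \<notin> ball 0 e" using e(2) * by blast
    then have "\<not> \<bar>r + e\<bar> < e" by (simp flip: of_real_add)
    ultimately show ?thesis by linarith
  qed
  then have "a - e *\<^sub>R 1 \<in> positive_elements"
    using positive_selfadjoint[OF a] by (simp add: positive_elements_iff star_diff star_scaleR)
  then show thesis using e(1) that by blast
qed

section \<open>The Hahn--Banach theorem for cones\<close>

text \<open>
  Only one inequality is required for homogeneity, since it is the one that passes to infima; the
  other follows from it with \<open>1/t\<close> in place of \<open>t\<close>.
\<close>

definition sublinear :: "('v::real_vector \<Rightarrow> real) \<Rightarrow> bool"
  where "sublinear p \<longleftrightarrow>
    (\<forall>x y. p (x + y) \<le> p x + p y) \<and> (\<forall>x. \<forall>t>0. p (t *\<^sub>R x) \<le> t * p x)"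

lemma sublinear_add: "sublinear p \<Longrightarrow> p (x + y) \<le> p x + p y"
  by (simp add: sublinear_def)

lemma sublinear_scaleR:
  assumes p: "sublinear p" and t: "0 \<le> t"
  shows "p (t *\<^sub>R x) = t * p x"
proof -
  have pos: "p (s *\<^sub>R y) = s * p y" if s: "s > 0" for s y
  proof (rule antisym)
    show "p (s *\<^sub>R y) \<le> s * p y" using p s by (simp add: sublinear_def)
    have "p ((1/s) *\<^sub>R (s *\<^sub>R y)) \<le> (1/s) * p (s *\<^sub>R y)"
      using p s unfolding sublinear_def by (metis zero_less_divide_1_iff)
    then show "s * p y \<le> p (s *\<^sub>R y)" using s by (simp add: field_simps)
  qed
  from pos[of 2 0] have "p 0 = 0" by simp
  then show ?thesis using pos[of t x] t by (cases "t = 0") auto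
qed

lemma sublinear_ge_minus:
  assumes "sublinear p"
  shows "- p (- x) \<le> p x"
  using sublinear_add[OF assms, of x "- x"] sublinear_scaleR[OF assms, of 0 x] by simp

text \<open>
  A minimal sublinear function \<open>m\<close> is linear: for each \<open>y\<close>, the function
  \<open>x \<mapsto> inf\<^sub>t (m (x + t y) - t m y)\<close> over \<open>t \<ge> 0\<close> is sublinear and below \<open>m\<close>, hence equal to
  \<open>m\<close>, and \<open>t = 1\<close> gives \<open>m x + m y \<le> m (x + y)\<close>.
\<close>

lemma minimal_sublinear_linear:
  assumes m: "sublinear m" and min: "\<And>q. sublinear q \<Longrightarrow> (\<And>x. q x \<le> m x) \<Longrightarrow> q = m"
  shows "linear m"
proof -
  have ge: "m x + m y \<le> m (x + y)" for x y
  proof -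
    define q where "q x = (INF t\<in>{0..}. m (x + t *\<^sub>R y) - t * m y)" for x
    have bdd: "bdd_below ((\<lambda>t. m (x + t *\<^sub>R y) - t * m y) ` {0..})" for x
    proof (rule bdd_belowI2)
      fix t :: real assume "t \<in> {0..}"
      then have "t * m y = m (t *\<^sub>R y)" using sublinear_scaleR[OF m] by simp
      also have "\<dots> \<le> m (x + t *\<^sub>R y) + m (- x)"
        using sublinear_add[OF m, of "x + t *\<^sub>R y" "- x"] by simp
      finally show "- m (- x) \<le> m (x + t *\<^sub>R y) - t * m y" by simp
    qed
    have le: "q x \<le> m (x + t *\<^sub>R y) - t * m y" if "0 \<le> t" for x t
      unfolding q_def using that by (intro cINF_lower bdd) auto
    have add: "q (x + x') \<le> q x + q x'" for x x'
    proof -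
      have "q (x + x') - (m (x + t *\<^sub>R y) - t * m y) \<le> q x'" if t: "0 \<le> t" for t
        unfolding q_def[of x']
      proof (rule cINF_greatest)
        fix s :: real assume "s \<in> {0..}"
        then have "q (x + x') \<le> m (x + x' + (t + s) *\<^sub>R y) - (t + s) * m y"
          using t by (intro le) auto
        also have "x + x' + (t + s) *\<^sub>R y = (x + t *\<^sub>R y) + (x' + s *\<^sub>R y)"
          by (simp add: algebra_simps)
        also have "m \<dots> \<le> m (x + t *\<^sub>R y) + m (x' + s *\<^sub>R y)" by (rule sublinear_add[OF m])
        finally show "q (x + x') - (m (x + t *\<^sub>R y) - t * m y) \<le> m (x' + s *\<^sub>R y) - s * m y"
          by (simp add: algebra_simps)
      qed auto
      then have "q (x + x') - q x' \<le> q x"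
        unfolding q_def[of x] by (intro cINF_greatest) (auto simp: algebra_simps)
      then show ?thesis by simp
    qed
    moreover have "q (s *\<^sub>R x) \<le> s * q x" if s: "s > 0" for s x
    proof -
      have "q (s *\<^sub>R x) / s \<le> q x"
        unfolding q_def[of x]
      proof (rule cINF_greatest)
        fix t :: real assume t: "t \<in> {0..}"
        have "q (s *\<^sub>R x) \<le> m (s *\<^sub>R x + (s * t) *\<^sub>R y) - (s * t) * m y"
          using s t by (intro le) auto
        also have "s *\<^sub>R x + (s * t) *\<^sub>R y = s *\<^sub>R (x + t *\<^sub>R y)" by (simp add: algebra_simps)
        also have "m \<dots> = s * m (x + t *\<^sub>R y)" using s by (intro sublinear_scaleR[OF m]) auto
        finally show "q (s *\<^sub>R x) / s \<le> m (x + t *\<^sub>R y) - t * m y"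
          using s by (simp add: field_simps)
      qed auto
      then show ?thesis using s by (simp add: field_simps)
    qed
    ultimately have "sublinear q" by (simp add: sublinear_def)
    then have "q = m" using le[of 0] by (intro min) auto
    then show ?thesis using le[of 1 x] by simp
  qed
  have add: "m (x + y) = m x + m y" for x y
    using ge sublinear_add[OF m] by (intro antisym) auto
  have "m (t *\<^sub>R x) = t * m x" for t x
  proof (cases "t \<ge> 0")
    case True
    then show ?thesis by (rule sublinear_scaleR[OF m])
  next
    case False
    then have "m ((- t) *\<^sub>R x) = - t * m x" using sublinear_scaleR[OF m, of "- t" x] by simp
    moreover have "m (t *\<^sub>R x) + m ((- t) *\<^sub>R x) = 0"
      using add[of "t *\<^sub>R x" "(- t) *\<^sub>R x"] sublinear_scaleR[OF m, of 0 x] by simp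
    ultimately show ?thesis by simp
  qed
  then show ?thesis using add by (intro linearI) auto
qed

text \<open>
  Minimal sublinear functions below \<open>p\<close> exist by Zorn's lemma: the pointwise infimum of a chain of
  them is finite, because \<open>- p (- x) \<le> q x\<close> for each sublinear \<open>q\<close> below \<open>p\<close>, and sublinear,
  because two members of the chain can be replaced by the smaller one.
\<close>

lemma linear_below_sublinear:
  assumes p: "sublinear p"
  obtains g where "linear g" "\<And>x. g x \<le> p x"
proof -
  let ?A = "{q. sublinear q \<and> (\<forall>x. q x \<le> p x)}"
  let ?P = "\<lambda>q r. \<forall>x. r x \<le> (q x :: real)"
  have "partial_order_on ?A (relation_of ?P ?A)"
    by (rule partial_order_on_relation_ofI) (auto simp: fun_eq_iff intro: order_trans antisym)
  moreover have "\<exists>u\<in>?A. \<forall>q\<in>C. ?P q u" if C: "C \<in> Chains (relation_of ?P ?A)" for C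
  proof (cases "C = {}")
    case True
    then show ?thesis using p by auto
  next
    case False
    have CA: "sublinear q" "q x \<le> p x" if "q \<in> C" for q x
      using C that by (auto simp: Chains_def relation_of_def)
    have total: "?P q r \<or> ?P r q" if "q \<in> C" "r \<in> C" for q r
      using C that by (auto simp: Chains_def relation_of_def)
    define u where "u x = (INF q\<in>C. q x)" for x
    have le: "u x \<le> q x" if "q \<in> C" for q x
      unfolding u_def
    proof (rule cINF_lower[OF bdd_belowI2 that])
      fix r assume "r \<in> C"
      show "- p (- x) \<le> r x"
        using sublinear_ge_minus[OF CA(1)[OF \<open>r \<in> C\<close>], of x] CA(2)[OF \<open>r \<in> C\<close>, of "- x"] by linarith
    qed
    have "u (x + y) \<le> u x + u y" for x y
    proof -
      have *: "u (x + y) \<le> q x + r y" if q: "q \<in> C" and r: "r \<in> C" for q r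
      proof -
        obtain k where k: "k \<in> C" "\<And>x. k x \<le> q x" "\<And>x. k x \<le> r x"
          using total[OF q r] q r by (metis order_refl)
        show ?thesis
          using le[OF k(1), of "x + y"] sublinear_add[OF CA(1)[OF k(1)], of x y] k(2)[of x] k(3)[of y]
          by linarith
      qed
      have "u (x + y) - r y \<le> u x" if "r \<in> C" for r
        unfolding u_def[of x] using *[OF _ that] False by (intro cINF_greatest) (auto simp: algebra_simps)
      then have "u (x + y) - u x \<le> u y"
        unfolding u_def[of y] using False by (intro cINF_greatest) (auto simp: algebra_simps)
      then show ?thesis by simp
    qed
    moreover have "u (t *\<^sub>R x) \<le> t * u x" if t: "t > 0" for t x
    proof -
      have "u (t *\<^sub>R x) / t \<le> u x"
        unfolding u_def[of x]
      proof (rule cINF_greatest[OF False])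
        fix q assume q: "q \<in> C"
        have "u (t *\<^sub>R x) \<le> t * q x"
          using le[OF q, of "t *\<^sub>R x"] sublinear_scaleR[OF CA(1)[OF q], of t x] t by simp
        then show "u (t *\<^sub>R x) / t \<le> q x" using t by (simp add: field_simps)
      qed
      then show ?thesis using t by (simp add: field_simps)
    qed
    ultimately have "sublinear u" by (simp add: sublinear_def)
    moreover have "u x \<le> p x" for x
      using False le CA(2) by (metis ex_in_conv order_trans)
    ultimately show ?thesis using le by blast
  qed
  ultimately obtain m where m: "m \<in> ?A" "\<And>q. q \<in> ?A \<Longrightarrow> ?P m q \<Longrightarrow> q = m"
    using predicate_Zorn[of ?A ?P] by blast
  have "linear m"
  proof (rule minimal_sublinear_linear)
    fix q assume q: "sublinear q" "\<And>x. q x \<le> m x"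
    then have "q x \<le> p x" for x using m(1) order_trans by blast
    then show "q = m" using q by (intro m(2)) auto
  qed (use m(1) in blast)
  then show thesis using m(1) that by blast
qed

text \<open>
  A cone of pairs \<open>(c, x)\<close> is read as a family of constraints \<open>g x \<le> c\<close> on a linear functional
  \<open>g\<close>. If every \<open>x\<close> is constrained, the constraints can be met as soon as they imply no contradictory
  constraint on \<open>g 0\<close>: the infimum of the bounds at \<open>x\<close> is then finite, as adding a bound \<open>d\<close> at \<open>- x\<close>
  shows, and it is sublinear in \<open>x\<close>.
\<close>

lemma linear_functional_for_cone:
  fixes K :: "(real \<times> 'v::real_vector) set"
  assumes add: "\<And>c d x y. (c, x) \<in> K \<Longrightarrow> (d, y) \<in> K \<Longrightarrow> (c + d, x + y) \<in> K"
    and scale: "\<And>c x t. (c, x) \<in> K \<Longrightarrow> t > 0 \<Longrightarrow> (t * c, t *\<^sub>R x) \<in> K"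
    and total: "\<And>x. \<exists>c. (c, x) \<in> K"
    and consistent: "\<And>c. (c, 0) \<in> K \<Longrightarrow> 0 \<le> c"
  obtains g where "linear g" "\<And>c x. (c, x) \<in> K \<Longrightarrow> g x \<le> c"
proof -
  define p where "p x = Inf {c. (c, x) \<in> K}" for x
  have ne: "{c. (c, x) \<in> K} \<noteq> {}" for x using total by simp
  have bdd: "bdd_below {c. (c, x) \<in> K}" for x
  proof -
    obtain d where d: "(d, - x) \<in> K" using total by blast
    show ?thesis
    proof (rule bdd_belowI)
      fix c assume "c \<in> {c. (c, x) \<in> K}"
      then show "- d \<le> c" using consistent add[OF _ d, of c x] by fastforce
    qed
  qed
  have le: "p x \<le> c" if "(c, x) \<in> K" for c x
    unfolding p_def using that by (intro cInf_lower bdd) auto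
  have "p (x + y) \<le> p x + p y" for x y
  proof -
    have "p (x + y) - d \<le> p x" if d: "(d, y) \<in> K" for d
      unfolding p_def[of x]
      using le[OF add[OF _ d, of _ x]] ne[of x] by (intro cInf_greatest) (auto simp: algebra_simps)
    then have "p (x + y) - p x \<le> p y"
      unfolding p_def[of y] using ne[of y] by (intro cInf_greatest) (auto simp: algebra_simps)
    then show ?thesis by simp
  qed
  moreover have "p (t *\<^sub>R x) \<le> t * p x" if t: "t > 0" for t x
  proof -
    have "p (t *\<^sub>R x) / t \<le> p x"
      unfolding p_def[of x]
    proof (rule cInf_greatest[OF ne])
      fix c assume "c \<in> {c. (c, x) \<in> K}"
      then have "p (t *\<^sub>R x) \<le> t * c" using t by (intro le scale) auto
      then show "p (t *\<^sub>R x) / t \<le> c" using t by (simp add: field_simps)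
    qed
    then show ?thesis using t by (simp add: field_simps)
  qed
  ultimately have "sublinear p" by (simp add: sublinear_def)
  then obtain g where "linear g" "\<And>x. g x \<le> p x" by (rule linear_below_sublinear) blast
  then show thesis using le that by (meson order_trans)
qed

section \<open>Hermitian and positive functionals\<close>

definition re_part :: "'a::cstar_algebra \<Rightarrow> 'a"
  where "re_part x = (1/2) *\<^sub>R (x + star x)"

definition im_part :: "'a::cstar_algebra \<Rightarrow> 'a"
  where "im_part x = scaleC (- \<i> / 2) (x - star x)"

lemma re_im_decomposition: "x = re_part x + scaleC \<i> (im_part (x::'a::cstar_algebra))"
proof -
  have "scaleC \<i> (im_part x) = (1/2) *\<^sub>R (x - star x)"
    by (simp add: im_part_def scaleC_scaleC flip: scaleC_of_real)
  then have "re_part x + scaleC \<i> (im_part x) = (1/2) *\<^sub>R (x + x)"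
    by (simp add: re_part_def flip: scaleR_add_right)
  then show ?thesis by (simp flip: scaleR_2)
qed

lemma star_re_part: "star (re_part x) = re_part (x::'a::cstar_algebra)"
  by (simp add: re_part_def star_scaleR star_add star_star add.commute)

lemma star_im_part: "star (im_part x) = im_part (x::'a::cstar_algebra)"
  by (simp add: im_part_def star_scaleC star_diff star_star scaleC_diff_right scaleC_minus_left)

lemma re_part_selfadjoint: "star x = x \<Longrightarrow> re_part x = (x::'a::cstar_algebra)"
  by (simp add: re_part_def flip: scaleR_2)

lemma im_part_selfadjoint: "star x = x \<Longrightarrow> im_part x = (0::'a::cstar_algebra)"
  by (simp add: im_part_def)

lemma re_part_star: "re_part (star x) = re_part (x::'a::cstar_algebra)"
  by (simp add: re_part_def star_star add.commute)

lemma im_part_star: "im_part (star x) = - im_part (x::'a::cstar_algebra)"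
  by (simp add: im_part_def star_star scaleC_diff_right)

lemma re_part_add: "re_part (x + y) = re_part x + re_part (y::'a::cstar_algebra)"
  by (simp add: re_part_def star_add algebra_simps)

lemma im_part_add: "im_part (x + y) = im_part x + im_part (y::'a::cstar_algebra)"
  by (simp add: im_part_def star_add scaleC_add_right scaleC_diff_right)

lemma re_part_scaleR: "re_part (r *\<^sub>R x) = r *\<^sub>R re_part (x::'a::cstar_algebra)"
  by (simp add: re_part_def star_scaleR algebra_simps)

lemma im_part_scaleR: "im_part (r *\<^sub>R x) = r *\<^sub>R im_part (x::'a::cstar_algebra)"
  by (simp add: im_part_def star_scaleR scaleC_diff_right scaleC_scaleR scaleR_scaleC
      scaleR_diff_right mult.commute)

lemma re_part_imaginary: "re_part (scaleC \<i> x) = - im_part (x::'a::cstar_algebra)"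
  by (simp add: re_part_def im_part_def star_scaleC scaleC_diff_right scaleC_add_right
      scaleR_scaleC scaleC_scaleC scaleC_minus_left scaleR_add_right scaleR_diff_right)

lemma im_part_imaginary: "im_part (scaleC \<i> x) = re_part (x::'a::cstar_algebra)"
  by (simp add: re_part_def im_part_def star_scaleC scaleC_diff_right scaleC_add_right
      scaleC_scaleC scaleC_minus_left scaleC_minus_right scaleR_add_right flip: scaleC_of_real)

lemma norm_re_part_le: "norm (re_part x) \<le> norm (x::'a::cstar_algebra)"
  using norm_triangle_ineq[of x "star x"] by (simp add: re_part_def)

lemma norm_im_part_le: "norm (im_part x) \<le> norm (x::'a::cstar_algebra)"
  using norm_triangle_ineq4[of x "star x"] by (simp add: im_part_def norm_scaleC norm_divide)

lemma cstar_dual_simps: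
  assumes "f \<in> cstar_dual"
  shows "f (x + y) = f x + f y" "f (x - y) = f x - f y" "f (r *\<^sub>R x) = r *\<^sub>R f x"
    "f (scaleC c x) = c * f x" "f 0 = 0" "f (- x) = - f x"
proof -
  interpret bounded_linear f using assms by (simp add: cstar_dual_def)
  show "f (x + y) = f x + f y" "f (x - y) = f x - f y" "f (r *\<^sub>R x) = r *\<^sub>R f x" "f 0 = 0"
    "f (- x) = - f x"
    by (simp_all add: add diff scaleR zero neg)
  show "f (scaleC c x) = c * f x" using assms by (simp add: cstar_dual_def)
qed

lemma positive_dualD:
  assumes "f \<in> positive_dual"
  shows "f \<in> cstar_dual" "x \<in> positive_elements \<Longrightarrow> f x \<in> \<real>"
    "x \<in> positive_elements \<Longrightarrow> 0 \<le> Re (f x)"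
  using assms by (auto simp: positive_dual_def)

lemma positive_dual_mono:
  assumes f: "f \<in> positive_dual" and xy: "y - x \<in> positive_elements"
  shows "Re (f x) \<le> Re (f y)"
  using positive_dualD(3)[OF f xy] by (simp add: cstar_dual_simps[OF positive_dualD(1)[OF f]])

text \<open>Because \<open>- \<parallel>x\<parallel> 1 \<le> x \<le> \<parallel>x\<parallel> 1\<close>.\<close>

lemma positive_dual_selfadjoint_bound:
  assumes f: "f \<in> positive_dual" and x: "star x = (x::'a::cstar_algebra)"
  shows "cmod (f x) \<le> norm x * Re (f 1)"
proof -
  note lin = cstar_dual_simps[OF positive_dualD(1)[OF f]]
  have p: "norm x *\<^sub>R 1 - x \<in> positive_elements" "norm x *\<^sub>R 1 - (- x) \<in> positive_elements"
    using x by (auto intro!: positive_norm_minus simp: star_minus simp del: diff_minus_eq_add)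
  have "f x = norm x *\<^sub>R f 1 - f (norm x *\<^sub>R 1 - x)" by (simp add: lin)
  then have "f x \<in> \<real>"
    using positive_dualD(2)[OF f p(1)] positive_dualD(2)[OF f positive_one]
    by (simp add: scaleR_conv_of_real)
  then have "cmod (f x) = \<bar>Re (f x)\<bar>" by (auto elim!: Reals_cases)
  then show ?thesis
    using positive_dual_mono[OF f p(1)] positive_dual_mono[OF f p(2)] by (simp add: lin)
qed

lemma positive_dual_onorm_le:
  fixes f :: "'a::cstar_algebra \<Rightarrow> complex"
  assumes f: "f \<in> positive_dual"
  shows "onorm f \<le> 2 * Re (f 1)"
proof (rule onorm_bound)
  have one: "0 \<le> Re (f 1)" by (rule positive_dualD(3)[OF f positive_one])
  then show "0 \<le> 2 * Re (f 1)" by simp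
  fix x :: 'a
  have "f x = f (re_part x) + \<i> * f (im_part x)"
    by (subst re_im_decomposition[of x]) (simp add: cstar_dual_simps[OF positive_dualD(1)[OF f]])
  then have "cmod (f x) \<le> cmod (f (re_part x)) + cmod (f (im_part x))"
    by (metis norm_triangle_ineq norm_mult norm_ii mult_1)
  also have "\<dots> \<le> norm (re_part x) * Re (f 1) + norm (im_part x) * Re (f 1)"
    by (intro add_mono positive_dual_selfadjoint_bound f star_re_part star_im_part)
  also have "\<dots> \<le> norm x * Re (f 1) + norm x * Re (f 1)"
    by (intro add_mono mult_right_mono norm_re_part_le norm_im_part_le one)
  finally show "cmod (f x) \<le> 2 * Re (f 1) * norm x" by (simp add: mult_ac)
qed

text \<open>
  A real linear functional that is nonnegative on the cone determines, through its values on the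
  self-adjoint elements, a positive functional on the algebra. No continuity has to be assumed of
  \<open>g\<close>: the order bounds \<open>\<bar>g x\<bar>\<close> by \<open>\<parallel>x\<parallel> g 1\<close>.
\<close>

lemma positive_functional_extension:
  fixes g :: "'a::cstar_algebra \<Rightarrow> real"
  assumes g: "linear g" and pos: "\<And>x. x \<in> positive_elements \<Longrightarrow> 0 \<le> g x"
  obtains f where "f \<in> positive_dual" "f \<in> hermitian_dual"
    "\<And>x. star x = x \<Longrightarrow> f x = complex_of_real (g x)"
proof -
  interpret g: linear g by (rule g)
  define f where "f x = Complex (g (re_part x)) (g (im_part x))" for x
  have bound: "\<bar>g x\<bar> \<le> norm x * g 1" if x: "star x = x" for x
  proof -
    have "norm x *\<^sub>R 1 - x \<in> positive_elements" "norm x *\<^sub>R 1 - (- x) \<in> positive_elements"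
      using x by (auto intro!: positive_norm_minus simp: star_minus simp del: diff_minus_eq_add)
    from this[THEN pos] show ?thesis
      by (simp add: g.diff g.scaleR g.add)
  qed
  have "bounded_linear f"
  proof (rule bounded_linear_intro)
    fix x y :: 'a and r :: real
    show "f (x + y) = f x + f y"
      by (simp add: f_def re_part_add im_part_add g.add complex_eq_iff)
    show "f (r *\<^sub>R x) = r *\<^sub>R f x"
      by (simp add: f_def re_part_scaleR im_part_scaleR g.scaleR complex_eq_iff)
    have "cmod (f x) \<le> \<bar>g (re_part x)\<bar> + \<bar>g (im_part x)\<bar>"
      using cmod_le[of "f x"] by (simp add: f_def)
    also have "\<dots> \<le> norm (re_part x) * g 1 + norm (im_part x) * g 1"
      by (intro add_mono bound star_re_part star_im_part)
    also have "\<dots> \<le> norm x * g 1 + norm x * g 1"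
      by (intro add_mono mult_right_mono norm_re_part_le norm_im_part_le pos positive_one)
    finally show "cmod (f x) \<le> norm x * (2 * g 1)" by simp
  qed
  moreover have "f (scaleC c x) = c * f x" for c x
  proof -
    interpret f: bounded_linear f by fact
    have i: "f (scaleC \<i> x) = \<i> * f x"
      by (simp add: f_def re_part_imaginary im_part_imaginary g.neg complex_eq_iff)
    have "scaleC c x = scaleC (Re c + \<i> * Im c) x" by (simp flip: complex_eq)
    also have "\<dots> = Re c *\<^sub>R x + Im c *\<^sub>R scaleC \<i> x"
      by (simp add: scaleC_add_left scaleR_scaleC scaleC_of_real mult.commute)
    finally have "f (scaleC c x) = (Re c + \<i> * Im c) * f x"
      by (simp add: f.add f.scaleR i) (simp add: scaleR_conv_of_real algebra_simps)
    then show ?thesis by (simp flip: complex_eq)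
  qed
  ultimately have dual: "f \<in> cstar_dual" by (simp add: cstar_dual_def)
  moreover have eq: "f x = complex_of_real (g x)" if "star x = x" for x
    using that by (simp add: f_def re_part_selfadjoint im_part_selfadjoint g.zero complex_eq_iff)
  ultimately have "f \<in> positive_dual"
    using pos by (simp add: positive_dual_def positive_selfadjoint)
  moreover have "f (star x) = cnj (f x)" for x
    by (simp add: f_def re_part_star im_part_star g.neg complex_eq_iff)
  then have "f \<in> hermitian_dual" using dual by (simp add: hermitian_dual_def)
  ultimately show thesis using eq that by blast
qed

text \<open>
  A Jordan decomposition, up to a constant: a positive functional \<open>g\<close> above \<open>f\<close> on the cone
  and with \<open>g 1 \<le> \<parallel>f\<parallel>\<close> is described by the constraints \<open>g (t 1 - u - y) \<le> \<parallel>f\<parallel> t - f y\<close> for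
  positive \<open>u\<close> and \<open>y\<close>. They are consistent because \<open>t 1 = u + y\<close> forces \<open>\<parallel>y\<parallel> \<le> t\<close>.
\<close>

lemma hermitian_dual_decomposition:
  fixes f :: "'a::cstar_algebra \<Rightarrow> complex"
  assumes f: "f \<in> hermitian_dual"
  obtains f1 f2 where "f1 \<in> positive_dual" "f2 \<in> positive_dual" "f = (\<lambda>x. f1 x - f2 x)"
    "Re (f1 1) + Re (f2 1) \<le> 3 * onorm f"
proof -
  have dual: "f \<in> cstar_dual" using f by (simp add: hermitian_dual_def)
  note lin = cstar_dual_simps[OF dual]
  have bl: "bounded_linear f" using dual by (simp add: cstar_dual_def)
  have cmod_f: "cmod (f x) \<le> onorm f * norm x" for x by (rule onorm[OF bl])
  have Re_f: "Re (f x) \<le> onorm f * norm x" for x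
    using cmod_f[of x] complex_Re_le_cmod[of "f x"] by linarith
  have f_real: "f x \<in> \<real>" if "star x = x" for x
  proof -
    have "f (star x) = cnj (f x)" using f by (simp add: hermitian_dual_def)
    then show ?thesis using that by (simp add: Reals_cnj_iff)
  qed
  define K where "K = {(c, x). \<exists>t y. c = onorm f * t - Re (f y) \<and> y \<in> positive_elements \<and>
    t *\<^sub>R 1 - re_part x - y \<in> positive_elements}"
  have KI: "(onorm f * t - Re (f y), x) \<in> K"
    if "y \<in> positive_elements" "t *\<^sub>R 1 - re_part x - y \<in> positive_elements" for t x y
    using that unfolding K_def by blast
  obtain g where g: "linear g" "\<And>c x. (c, x) \<in> K \<Longrightarrow> g x \<le> c"
  proof (rule linear_functional_for_cone)
    fix c d x y assume "(c, x) \<in> K" "(d, y) \<in> K"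
    then obtain t u s v where *: "c = onorm f * t - Re (f u)" "u \<in> positive_elements"
      "t *\<^sub>R 1 - re_part x - u \<in> positive_elements"
      "d = onorm f * s - Re (f v)" "v \<in> positive_elements"
      "s *\<^sub>R 1 - re_part y - v \<in> positive_elements"
      unfolding K_def by blast
    have "(t + s) *\<^sub>R 1 - re_part (x + y) - (u + v) =
        (t *\<^sub>R 1 - re_part x - u) + (s *\<^sub>R 1 - re_part y - v)"
      by (simp add: re_part_add algebra_simps)
    also have "\<dots> \<in> positive_elements" by (intro positive_add *)
    finally have "(onorm f * (t + s) - Re (f (u + v)), x + y) \<in> K"
      by (intro KI positive_add *)
    then show "(c + d, x + y) \<in> K" by (simp add: * lin algebra_simps)
  next
    fix c x and r :: real assume "(c, x) \<in> K" and r: "r > 0"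
    then obtain t u where *: "c = onorm f * t - Re (f u)" "u \<in> positive_elements"
      "t *\<^sub>R 1 - re_part x - u \<in> positive_elements"
      unfolding K_def by blast
    have "(r * t) *\<^sub>R 1 - re_part (r *\<^sub>R x) - r *\<^sub>R u = r *\<^sub>R (t *\<^sub>R 1 - re_part x - u)"
      by (simp add: re_part_scaleR algebra_simps)
    also have "\<dots> \<in> positive_elements" using r by (intro positive_scaleR *) auto
    finally have "(onorm f * (r * t) - Re (f (r *\<^sub>R u)), r *\<^sub>R x) \<in> K"
      using r by (intro KI positive_scaleR *) auto
    then show "(r * c, r *\<^sub>R x) \<in> K" by (simp add: * lin algebra_simps)
  next
    fix x :: 'a
    have "norm x *\<^sub>R 1 - re_part x - 0 \<in> positive_elements"
      using positive_norm_minus[OF star_re_part norm_re_part_le] by simp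
    then show "\<exists>c. (c, x) \<in> K" using KI[OF positive_zero] by blast
  next
    fix c :: real assume "(c, 0) \<in> K"
    then obtain t y where *: "c = onorm f * t - Re (f y)" "y \<in> positive_elements"
      "t *\<^sub>R 1 - y \<in> positive_elements"
      unfolding K_def by (auto simp: re_part_def)
    have "Re (f y) \<le> onorm f * norm y" by (rule Re_f)
    also have "\<dots> \<le> onorm f * t"
      by (intro mult_left_mono positive_norm_le * onorm_pos_le[OF bl])
    finally show "0 \<le> c" using *(1) by simp
  qed blast
  interpret g: linear g by (rule g(1))
  \<comment> \<open>The constraint with \<open>t = 0\<close>, \<open>y = 0\<close>, \<open>u = x\<close>.\<close>
  have g_pos: "0 \<le> g x" if x: "x \<in> positive_elements" for x
  proof -
    have "(onorm f * 0 - Re (f 0), - x) \<in> K"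
      using x re_part_selfadjoint[of "- x"] positive_selfadjoint[OF x]
      by (intro KI positive_zero) (simp add: star_minus)
    then show ?thesis using g(2) by (fastforce simp: lin g.neg)
  qed
  \<comment> \<open>The constraint with \<open>t = 0\<close>, \<open>y = x\<close>, \<open>u = 0\<close>.\<close>
  have g_ge: "Re (f x) \<le> g x" if x: "x \<in> positive_elements" for x
  proof -
    have "(onorm f * 0 - Re (f x), - x) \<in> K"
      using x re_part_selfadjoint[of "- x"] positive_selfadjoint[OF x]
      by (intro KI) (simp_all add: star_minus positive_zero)
    then show ?thesis using g(2) by (fastforce simp: lin g.neg)
  qed
  have "(onorm f * 1 - Re (f 0), 1) \<in> K"
    by (intro KI) (simp_all add: re_part_selfadjoint positive_zero)
  then have g_one: "g 1 \<le> onorm f" using g(2) by (fastforce simp: lin)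
  obtain f1 where f1: "f1 \<in> positive_dual" "\<And>x. star x = x \<Longrightarrow> f1 x = complex_of_real (g x)"
    using positive_functional_extension[OF g(1) g_pos] by blast
  define f2 where "f2 x = f1 x - f x" for x
  have f1d: "f1 \<in> cstar_dual" by (rule positive_dualD(1)[OF f1(1)])
  have "bounded_linear f2"
    unfolding f2_def using f1d bl by (intro bounded_linear_sub) (simp_all add: cstar_dual_def)
  then have "f2 \<in> cstar_dual"
    by (simp add: cstar_dual_def f2_def lin cstar_dual_simps[OF f1d] algebra_simps)
  moreover have "f2 x \<in> \<real> \<and> 0 \<le> Re (f2 x)" if x: "x \<in> positive_elements" for x
    using g_ge[OF x] f1(2)[of x] f_real[of x] positive_selfadjoint[OF x] by (simp add: f2_def)
  ultimately have "f2 \<in> positive_dual" by (simp add: positive_dual_def)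
  moreover have "f = (\<lambda>x. f1 x - f2 x)" by (simp add: f2_def fun_eq_iff)
  moreover have "Re (f1 1) + Re (f2 1) \<le> 3 * onorm f"
    using g_one f1(2)[of 1] cmod_f[of 1] abs_Re_le_cmod[of "f 1"] by (simp add: f2_def)
  ultimately show thesis using that f1(1) by blast
qed

section \<open>The seminorms\<close>

definition decomposition_values :: "'a::cstar_algebra \<Rightarrow> ('a \<Rightarrow> complex) \<Rightarrow> real set"
  where "decomposition_values b f = {Re (f1 b) + Re (f2 b) | f1 f2.
      f1 \<in> positive_dual \<and> f2 \<in> positive_dual \<and> f = (\<lambda>x. f1 x - f2 x)}"

lemma r_seminorm_Inf: "r_seminorm b f = Inf (decomposition_values b f)"
  by (simp add: r_seminorm_def decomposition_values_def)

lemma decomposition_values_nonempty: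
  fixes f :: "'a::cstar_algebra \<Rightarrow> complex"
  assumes "f \<in> hermitian_dual"
  shows "decomposition_values b f \<noteq> {}"
proof -
  obtain f1 f2 where "f1 \<in> positive_dual" "f2 \<in> positive_dual" "f = (\<lambda>x. f1 x - f2 x)"
    by (rule hermitian_dual_decomposition[OF assms])
  then have "Re (f1 b) + Re (f2 b) \<in> decomposition_values b f"
    unfolding decomposition_values_def by blast
  then show ?thesis by blast
qed

lemma decomposition_values_nonneg:
  assumes "b \<in> positive_elements" "v \<in> decomposition_values b f"
  shows "0 \<le> v"
proof -
  obtain f1 f2 where "f1 \<in> positive_dual" "f2 \<in> positive_dual" "v = Re (f1 b) + Re (f2 b)"
    using assms(2) unfolding decomposition_values_def by blast
  then show ?thesis using positive_dualD(3)[OF _ assms(1)] by (simp add: add_nonneg_nonneg)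
qed

lemma r_seminorm_le:
  assumes "b \<in> positive_elements" "v \<in> decomposition_values b f"
  shows "r_seminorm b f \<le> v"
  unfolding r_seminorm_Inf
  by (rule cInf_lower[OF assms(2) bdd_belowI[OF decomposition_values_nonneg[OF assms(1)]]])

lemma r_seminorm_greatest:
  fixes f :: "'a::cstar_algebra \<Rightarrow> complex"
  assumes "f \<in> hermitian_dual" "\<And>v. v \<in> decomposition_values b f \<Longrightarrow> c \<le> v"
  shows "c \<le> r_seminorm b f"
  unfolding r_seminorm_Inf
  by (rule cInf_greatest[OF decomposition_values_nonempty[OF assms(1)] assms(2)])

lemma positive_dual_add:
  assumes "f \<in> positive_dual" "g \<in> positive_dual"
  shows "(\<lambda>x. f x + g x) \<in> positive_dual"
proof -
  have "bounded_linear (\<lambda>x. f x + g x)"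
    using assms by (intro bounded_linear_add) (simp_all add: positive_dual_def cstar_dual_def)
  then have "(\<lambda>x. f x + g x) \<in> cstar_dual"
    using assms[THEN positive_dualD(1)] by (simp add: cstar_dual_def distrib_left)
  then show ?thesis
    using assms by (simp add: positive_dual_def)
qed

lemma positive_dual_scale:
  assumes "f \<in> positive_dual" "0 \<le> t"
  shows "(\<lambda>x. complex_of_real t * f x) \<in> positive_dual"
proof -
  have "bounded_linear (\<lambda>x. complex_of_real t * f x)"
    using assms by (intro bounded_linear_const_mult) (simp add: positive_dual_def cstar_dual_def)
  then have "(\<lambda>x. complex_of_real t * f x) \<in> cstar_dual"
    using positive_dualD(1)[OF assms(1)] by (simp add: cstar_dual_def)
  then show ?thesis
    using assms by (simp add: positive_dual_def)
qed

lemma decomposition_values_scale: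
  fixes f :: "'a::cstar_algebra \<Rightarrow> complex"
  assumes "v \<in> decomposition_values b f"
  shows "\<bar>t\<bar> * v \<in> decomposition_values b (\<lambda>x. complex_of_real t * f x)"
proof -
  obtain f1 f2 where *: "f1 \<in> positive_dual" "f2 \<in> positive_dual" "f = (\<lambda>x. f1 x - f2 x)"
    "v = Re (f1 b) + Re (f2 b)"
    using assms unfolding decomposition_values_def by blast
  define h where "h f x = complex_of_real \<bar>t\<bar> * f x" for f :: "'a \<Rightarrow> complex" and x
  have h: "h f1 \<in> positive_dual" "h f2 \<in> positive_dual"
    unfolding h_def by (intro positive_dual_scale * abs_ge_zero)+
  have v: "\<bar>t\<bar> * v = Re (h f1 b) + Re (h f2 b)" by (simp add: h_def *(4) algebra_simps)
  show ?thesis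
  proof (cases "t \<ge> 0")
    case True
    then have "(\<lambda>x. complex_of_real t * f x) = (\<lambda>x. h f1 x - h f2 x)"
      by (simp add: h_def *(3) algebra_simps)
    then show ?thesis using h v unfolding decomposition_values_def by blast
  next
    case False
    then have "(\<lambda>x. complex_of_real t * f x) = (\<lambda>x. h f2 x - h f1 x)"
      by (simp add: h_def *(3) algebra_simps)
    moreover have "\<bar>t\<bar> * v = Re (h f2 b) + Re (h f1 b)" using v by simp
    ultimately show ?thesis using h unfolding decomposition_values_def by blast
  qed
qed

lemma decomposition_values_add:
  assumes "v \<in> decomposition_values b f" "w \<in> decomposition_values b g"
  shows "v + w \<in> decomposition_values b (\<lambda>x. f x + g x)"
proof -
  obtain f1 f2 g1 g2 where *: "f1 \<in> positive_dual" "f2 \<in> positive_dual" "f = (\<lambda>x. f1 x - f2 x)"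
    "v = Re (f1 b) + Re (f2 b)" "g1 \<in> positive_dual" "g2 \<in> positive_dual"
    "g = (\<lambda>x. g1 x - g2 x)" "w = Re (g1 b) + Re (g2 b)"
    using assms unfolding decomposition_values_def by blast
  have "v + w = Re (f1 b + g1 b) + Re (f2 b + g2 b)"
    "(\<lambda>x. f x + g x) = (\<lambda>x. (f1 x + g1 x) - (f2 x + g2 x))"
    by (simp_all add: *(3,4,7,8) fun_eq_iff)
  then show ?thesis
    using positive_dual_add[OF *(1,5)] positive_dual_add[OF *(2,6)]
    unfolding decomposition_values_def
    by (intro CollectI exI[of _ "\<lambda>x. f1 x + g1 x"] exI[of _ "\<lambda>x. f2 x + g2 x"] conjI)
qed

lemma hermitian_dual_scale:
  "f \<in> hermitian_dual \<Longrightarrow> (\<lambda>x. complex_of_real t * f x) \<in> hermitian_dual"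
  using bounded_linear_const_mult[of f "complex_of_real t"]
  by (simp add: hermitian_dual_def cstar_dual_def)

lemma hermitian_dual_bounded_linear: "f \<in> hermitian_dual \<Longrightarrow> bounded_linear f"
  by (simp add: hermitian_dual_def cstar_dual_def)

lemma r_seminorm_scale:
  fixes f :: "'a::cstar_algebra \<Rightarrow> complex"
  assumes b: "b \<in> positive_elements" and f: "f \<in> hermitian_dual"
  shows "r_seminorm b (\<lambda>x. complex_of_real t * f x) = \<bar>t\<bar> * r_seminorm b f"
proof -
  have le: "r_seminorm b (\<lambda>x. complex_of_real s * h x) \<le> \<bar>s\<bar> * r_seminorm b h"
    if s: "s \<noteq> 0" and h: "h \<in> hermitian_dual" for s h
  proof -
    have "r_seminorm b (\<lambda>x. complex_of_real s * h x) / \<bar>s\<bar> \<le> r_seminorm b h"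
    proof (rule r_seminorm_greatest[OF h])
      fix v assume "v \<in> decomposition_values b h"
      then have "r_seminorm b (\<lambda>x. complex_of_real s * h x) \<le> \<bar>s\<bar> * v"
        by (intro r_seminorm_le[OF b] decomposition_values_scale)
      then show "r_seminorm b (\<lambda>x. complex_of_real s * h x) / \<bar>s\<bar> \<le> v"
        using s by (simp add: field_simps)
    qed
    then show ?thesis using s by (simp add: field_simps)
  qed
  have nonneg: "0 \<le> r_seminorm b h" if "h \<in> hermitian_dual" for h
    using r_seminorm_greatest[OF that] decomposition_values_nonneg[OF b] by blast
  show ?thesis
  proof (cases "t = 0")
    case True
    obtain v where "v \<in> decomposition_values b f" using decomposition_values_nonempty[OF f] by blast
    then have "r_seminorm b (\<lambda>x. complex_of_real 0 * f x) \<le> \<bar>0\<bar> * v"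
      by (intro r_seminorm_le[OF b] decomposition_values_scale)
    then show ?thesis using nonneg[OF hermitian_dual_scale[OF f, of 0]] True by simp
  next
    case False
    have "r_seminorm b (\<lambda>x. complex_of_real (1/t) * (complex_of_real t * f x)) \<le>
        \<bar>1/t\<bar> * r_seminorm b (\<lambda>x. complex_of_real t * f x)"
      using False by (intro le hermitian_dual_scale f) auto
    moreover have "(\<lambda>x. complex_of_real (1/t) * (complex_of_real t * f x)) = f"
      using False by (simp add: fun_eq_iff)
    ultimately have "r_seminorm b f \<le> \<bar>1/t\<bar> * r_seminorm b (\<lambda>x. complex_of_real t * f x)"
      by simp
    then have "\<bar>t\<bar> * r_seminorm b f \<le> r_seminorm b (\<lambda>x. complex_of_real t * f x)"
      using False by (simp add: field_simps)
    then show ?thesis using le[OF False f] by simp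
  qed
qed

lemma r_seminorm_triangle:
  fixes f g :: "'a::cstar_algebra \<Rightarrow> complex"
  assumes b: "b \<in> positive_elements" and f: "f \<in> hermitian_dual" and g: "g \<in> hermitian_dual"
  shows "r_seminorm b (\<lambda>x. f x + g x) \<le> r_seminorm b f + r_seminorm b g"
proof -
  have "r_seminorm b (\<lambda>x. f x + g x) - w \<le> r_seminorm b f" if w: "w \<in> decomposition_values b g" for w
  proof (rule r_seminorm_greatest[OF f])
    fix v assume "v \<in> decomposition_values b f"
    then show "r_seminorm b (\<lambda>x. f x + g x) - w \<le> v"
      using r_seminorm_le[OF b decomposition_values_add[OF _ w], of v f] by simp
  qed
  then have "r_seminorm b (\<lambda>x. f x + g x) - r_seminorm b f \<le> w"
    if "w \<in> decomposition_values b g" for w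
    using that by (simp add: diff_le_eq add.commute)
  then have "r_seminorm b (\<lambda>x. f x + g x) - r_seminorm b f \<le> r_seminorm b g"
    by (rule r_seminorm_greatest[OF g])
  then show ?thesis by simp
qed

lemma is_norm_on_onorm: "is_norm_on (hermitian_dual :: ('a::cstar_algebra \<Rightarrow> complex) set) onorm"
proof -
  have scale: "onorm (\<lambda>x. complex_of_real t * f x) = \<bar>t\<bar> * onorm f"
    if "f \<in> hermitian_dual" for t and f :: "'a \<Rightarrow> complex"
    using onorm_scaleR[OF hermitian_dual_bounded_linear[OF that], of t]
    by (simp add: scaleR_conv_of_real)
  show ?thesis
    unfolding is_norm_on_def
    by (auto simp: onorm_pos_le onorm_eq_0 hermitian_dual_bounded_linear scale fun_eq_iff
        intro!: onorm_triangle)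
qed

text \<open>
  On positive functionals, evaluation at \<open>1\<close> is comparable to the norm, and evaluation at a
  positive \<open>b\<close> with \<open>\<epsilon> 1 \<le> b\<close> is squeezed between \<open>\<epsilon>\<close> and \<open>\<parallel>b\<parallel>\<close> times evaluation at \<open>1\<close>.
\<close>

lemma invertible_imp_equivalent_norms:
  fixes b :: "'a::cstar_algebra"
  assumes b: "b \<in> positive_elements" and inv: "cstar_invertible b"
  shows "equivalent_norms_on hermitian_dual (r_seminorm b) onorm"
proof -
  obtain e where e: "e > 0" "b - e *\<^sub>R 1 \<in> positive_elements"
    using positive_invertible_ge[OF b inv] by blast
  have lower: "(e / 2) * onorm f \<le> r_seminorm b f" if f: "f \<in> hermitian_dual" for f
  proof (rule r_seminorm_greatest[OF f])
    fix v assume "v \<in> decomposition_values b f"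
    then obtain f1 f2 where *: "f1 \<in> positive_dual" "f2 \<in> positive_dual" "f = (\<lambda>x. f1 x - f2 x)"
      "v = Re (f1 b) + Re (f2 b)"
      unfolding decomposition_values_def by blast
    have bl: "bounded_linear f1" "bounded_linear f2"
      using *(1,2)[THEN positive_dualD(1)] by (simp_all add: cstar_dual_def)
    have ge: "(e / 2) * onorm h \<le> Re (h b)" if h: "h \<in> positive_dual" for h
    proof -
      have "(e / 2) * onorm h \<le> (e / 2) * (2 * Re (h 1))"
        using e(1) by (intro mult_left_mono positive_dual_onorm_le h) auto
      also have "\<dots> = Re (h (e *\<^sub>R 1))" by (simp add: cstar_dual_simps[OF positive_dualD(1)[OF h]])
      also have "\<dots> \<le> Re (h b)" by (rule positive_dual_mono[OF h e(2)])
      finally show ?thesis .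
    qed
    have "onorm (\<lambda>x. f1 x + - f2 x) \<le> onorm f1 + onorm (\<lambda>x. - f2 x)"
      by (intro onorm_triangle bl bounded_linear_minus)
    then have "onorm f \<le> onorm f1 + onorm f2"
      by (simp add: *(3) onorm_neg)
    then have "(e / 2) * onorm f \<le> (e / 2) * (onorm f1 + onorm f2)"
      using e(1) by (intro mult_left_mono) auto
    then show "(e / 2) * onorm f \<le> v" using ge[OF *(1)] ge[OF *(2)] by (simp add: *(4) distrib_left)
  qed
  have upper: "r_seminorm b f \<le> norm b * (3 * onorm f)" if f: "f \<in> hermitian_dual" for f
  proof -
    obtain f1 f2 where *: "f1 \<in> positive_dual" "f2 \<in> positive_dual" "f = (\<lambda>x. f1 x - f2 x)"
      "Re (f1 1) + Re (f2 1) \<le> 3 * onorm f"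
      by (rule hermitian_dual_decomposition[OF f])
    have le: "Re (h b) \<le> norm b * Re (h 1)" if h: "h \<in> positive_dual" for h
      using positive_dual_selfadjoint_bound[OF h positive_selfadjoint[OF b]]
        complex_Re_le_cmod[of "h b"] by linarith
    have "r_seminorm b f \<le> Re (f1 b) + Re (f2 b)"
      using * by (intro r_seminorm_le[OF b]) (auto simp: decomposition_values_def)
    also have "\<dots> \<le> norm b * Re (f1 1) + norm b * Re (f2 1)" by (intro add_mono le *)
    also have "\<dots> = norm b * (Re (f1 1) + Re (f2 1))" by (simp add: distrib_left)
    also have "\<dots> \<le> norm b * (3 * onorm f)" by (intro mult_left_mono * norm_ge_zero)
    finally show ?thesis .
  qed
  have "is_norm_on hermitian_dual (r_seminorm b)"
    unfolding is_norm_on_def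
  proof (intro conjI ballI allI)
    fix f :: "'a \<Rightarrow> complex" assume f: "f \<in> hermitian_dual"
    show ge: "0 \<le> r_seminorm b f"
      using r_seminorm_greatest[OF f] decomposition_values_nonneg[OF b] by blast
    have "onorm f \<le> 0" if "r_seminorm b f = 0"
      using lower[OF f] that e(1) by (simp add: mult_le_0_iff)
    then show "r_seminorm b f = 0 \<longleftrightarrow> f = (\<lambda>x. 0)"
      using upper[OF f] ge is_norm_on_onorm f unfolding is_norm_on_def
      by (metis antisym mult_zero_right)
  qed (use b in \<open>auto intro: r_seminorm_scale r_seminorm_triangle\<close>)
  moreover have pos: "norm b > 0"
    using inv not_invertible_zero by auto
  have "(1 / (3 * norm b)) * r_seminorm b f \<le> onorm f \<and> onorm f \<le> (2 / e) * r_seminorm b f"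
    if "f \<in> hermitian_dual" for f
    using lower[OF that] upper[OF that] pos e(1) by (simp add: field_simps)
  then have "\<exists>c>0. \<exists>C>0. \<forall>f \<in> hermitian_dual. c * r_seminorm b f \<le> onorm f \<and> onorm f \<le> C * r_seminorm b f"
    using pos e(1) by (intro exI[of _ "1 / (3 * norm b)"] exI[of _ "2 / e"] conjI) auto
  ultimately show ?thesis by (simp add: equivalent_norms_on_def is_norm_on_onorm)
qed

text \<open>
  If \<open>a\<close> is not invertible, some state vanishes at \<open>a\<close>, and \<open>r_seminorm a\<close> vanishes at that state.
  The constraints \<open>g x \<le> t\<close> whenever \<open>x \<le> t 1 + s a\<close> with \<open>s \<ge> 0\<close> describe such a state; they are
  consistent because \<open>t\<close> belongs to the spectrum of \<open>t 1 + s a\<close>.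
\<close>

lemma not_invertible_imp_state:
  fixes a :: "'a::cstar_algebra"
  assumes a: "a \<in> positive_elements" and ninv: "\<not> cstar_invertible a"
  obtains f where "f \<in> positive_dual" "f \<in> hermitian_dual" "Re (f a) \<le> 0" "f 1 \<noteq> 0"
proof -
  define K where "K = {(t, x). \<exists>s\<ge>0. t *\<^sub>R 1 + s *\<^sub>R a - re_part x \<in> positive_elements}"
  obtain g where g: "linear g" "\<And>c x. (c, x) \<in> K \<Longrightarrow> g x \<le> c"
  proof (rule linear_functional_for_cone)
    fix c d x y assume "(c, x) \<in> K" "(d, y) \<in> K"
    then obtain s r where *: "s \<ge> 0" "c *\<^sub>R 1 + s *\<^sub>R a - re_part x \<in> positive_elements"
      "r \<ge> 0" "d *\<^sub>R 1 + r *\<^sub>R a - re_part y \<in> positive_elements"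
      unfolding K_def by blast
    have "(c + d) *\<^sub>R 1 + (s + r) *\<^sub>R a - re_part (x + y) =
        (c *\<^sub>R 1 + s *\<^sub>R a - re_part x) + (d *\<^sub>R 1 + r *\<^sub>R a - re_part y)"
      by (simp add: re_part_add algebra_simps)
    also have "\<dots> \<in> positive_elements" by (intro positive_add *)
    finally show "(c + d, x + y) \<in> K"
      unfolding K_def using *(1,3) by (auto intro!: exI[of _ "s + r"])
  next
    fix c x and t :: real assume "(c, x) \<in> K" and t: "t > 0"
    then obtain s where *: "s \<ge> 0" "c *\<^sub>R 1 + s *\<^sub>R a - re_part x \<in> positive_elements"
      unfolding K_def by blast
    have "(t * c) *\<^sub>R 1 + (t * s) *\<^sub>R a - re_part (t *\<^sub>R x) = t *\<^sub>R (c *\<^sub>R 1 + s *\<^sub>R a - re_part x)"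
      by (simp add: re_part_scaleR algebra_simps)
    also have "\<dots> \<in> positive_elements" using t by (intro positive_scaleR *) auto
    finally show "(t * c, t *\<^sub>R x) \<in> K"
      unfolding K_def using *(1) t by (auto intro!: exI[of _ "t * s"])
  next
    fix x :: 'a
    have "norm x *\<^sub>R 1 + 0 *\<^sub>R a - re_part x \<in> positive_elements"
      using positive_norm_minus[OF star_re_part norm_re_part_le] by simp
    then show "\<exists>c. (c, x) \<in> K" unfolding K_def by blast
  next
    fix t :: real assume "(t, 0) \<in> K"
    then obtain s where s: "s \<ge> 0" "t *\<^sub>R 1 + s *\<^sub>R a \<in> positive_elements"
      unfolding K_def by (auto simp: re_part_def)
    have "\<not> cstar_invertible (s *\<^sub>R a)"
      using ninv invertible_scaleC[of "complex_of_real s" a] not_invertible_zero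
      by (cases "s = 0") (auto simp: scaleC_of_real)
    then have "complex_of_real t \<in> cstar_spectrum (t *\<^sub>R 1 + s *\<^sub>R a)"
      by (simp add: spectrum_iff scaleC_of_real invertible_minus)
    then show "0 \<le> t" by (rule positive_spectrum[OF s(2)])
  qed blast
  interpret g: linear g by (rule g(1))
  have "0 \<le> g x" if x: "x \<in> positive_elements" for x
  proof -
    have "(0, - x) \<in> K"
      unfolding K_def using x re_part_selfadjoint[of "- x"] positive_selfadjoint[OF x]
      by (auto simp: star_minus intro!: exI[of _ 0])
    then show ?thesis using g(2) by (fastforce simp: g.neg)
  qed
  then obtain f where f: "f \<in> positive_dual" "f \<in> hermitian_dual"
    "\<And>x. star x = x \<Longrightarrow> f x = complex_of_real (g x)"
    using positive_functional_extension[OF g(1)] by blast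
  have "(0, a) \<in> K"
    unfolding K_def using re_part_selfadjoint[OF positive_selfadjoint[OF a]]
    by (auto simp: positive_zero intro!: exI[of _ 1])
  then have "Re (f a) \<le> 0" using g(2) f(3)[OF positive_selfadjoint[OF a]] by simp
  moreover have "(- 1, - 1) \<in> K"
    unfolding K_def using re_part_selfadjoint[of "- 1 :: 'a"]
    by (auto simp: star_minus positive_zero intro!: exI[of _ 0])
  then have "g 1 \<ge> 1" using g(2) by (fastforce simp: g.neg)
  then have "f 1 \<noteq> 0" using f(3)[OF star_one] by simp
  ultimately show thesis using f that by blast
qed

lemma norm_r_seminorm_imp_invertible:
  fixes a :: "'a::cstar_algebra"
  assumes a: "a \<in> positive_elements" and norm: "is_norm_on hermitian_dual (r_seminorm a)"
  shows "cstar_invertible a"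
proof (rule ccontr)
  assume "\<not> cstar_invertible a"
  then obtain f where f: "f \<in> positive_dual" "f \<in> hermitian_dual" "Re (f a) \<le> 0" "f 1 \<noteq> 0"
    using not_invertible_imp_state[OF a] by blast
  have "(\<lambda>x::'a. 0) \<in> positive_dual"
    using positive_dual_scale[OF f(1), of 0] by simp
  then have "Re (f a) + Re 0 \<in> decomposition_values a f"
    using f(1) unfolding decomposition_values_def
    by (intro CollectI exI[of _ f] exI[of _ "\<lambda>x. 0"]) simp
  then have "r_seminorm a f \<le> 0" using r_seminorm_le[OF a] f(3) by fastforce
  then have "f = (\<lambda>x. 0)" using norm f(2) unfolding is_norm_on_def by (metis antisym)
  then show False using f(4) by simp
qed

section \<open>Polynomials of a self-adjoint element\<close>

definition poly_eval :: "'a::cstar_algebra \<Rightarrow> complex poly \<Rightarrow> 'a"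
  where "poly_eval a p = fold_coeffs (\<lambda>c y. scaleC c 1 + a * y) p 0"

lemma poly_eval_0 [simp]: "poly_eval a 0 = 0"
  by (simp add: poly_eval_def)

lemma poly_eval_pCons [simp]: "poly_eval a (pCons c p) = scaleC c 1 + a * poly_eval a p"
  by (cases "p = 0"; cases "c = 0") (simp_all add: poly_eval_def)

lemma poly_eval_add: "poly_eval a (p + q) = poly_eval a p + poly_eval a q"
  by (induction p q rule: poly_induct2) (simp_all add: scaleC_add_left algebra_simps)

lemma poly_eval_smult: "poly_eval a (smult c p) = scaleC c (poly_eval a p)"
  by (induction p) (simp_all add: scaleC_add_right scaleC_scaleC mult_scaleC_right)

lemma poly_eval_diff: "poly_eval a (p - q) = poly_eval a p - poly_eval a q"
  using poly_eval_add[of a p "- q"] poly_eval_smult[of a "- 1" q] by (simp add: scaleC_minus_left)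

lemma poly_eval_mult: "poly_eval a (p * q) = poly_eval a p * poly_eval a q"
  by (induction p)
    (simp_all add: poly_eval_add poly_eval_smult distrib_right mult_scaleC_left mult.assoc)

lemma poly_eval_star:
  assumes "star a = a"
  shows "poly_eval a (map_poly cnj p) = star (poly_eval a p)"
proof (induction p)
  case (pCons c p)
  have "a * poly_eval a p = poly_eval a p * a"
    using poly_eval_mult[of a "[:0, 1:]" p] poly_eval_mult[of a p "[:0, 1:]"]
    by (simp add: mult.commute[of p])
  then show ?case
    using pCons assms
    by (simp add: map_poly_pCons star_add star_scaleC star_mult)
qed simp

text \<open>
  The spectral mapping theorem for polynomials. By the fundamental theorem of algebra, \<open>p\<close> is a
  product of factors vanishing at its roots, so \<open>p(a)\<close> is invertible if no root is in the
  spectrum; and conversely \<open>z 1 - a\<close> is a factor of \<open>p(z) 1 - p(a)\<close>.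
\<close>

lemma poly_eval_invertible:
  assumes "p \<noteq> 0" "\<And>z. z \<in> cstar_spectrum a \<Longrightarrow> poly p z \<noteq> 0"
  shows "cstar_invertible (poly_eval a p)"
  using assms
proof (induction "degree p" arbitrary: p)
  case 0
  then obtain c where "p = [:c:]" by (metis degree_eq_zeroE)
  then show ?case
    using 0 invertible_scaleC[of c "1 :: 'a"] by (simp add: cstar_invertible_def)
next
  case (Suc n)
  then obtain z where z: "poly p z = 0"
    using fundamental_theorem_of_algebra[of p] by (auto simp: constant_degree)
  then obtain q where q: "p = [:- z, 1:] * q" using poly_eq_0_iff_dvd by (metis dvdE)
  have "q \<noteq> 0" using q Suc.prems(1) by auto
  then have "degree p = 1 + degree q" unfolding q by (subst degree_mult_eq) simp_all
  then have "cstar_invertible (poly_eval a q)"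
    using Suc.hyps(2) Suc.prems(2) \<open>q \<noteq> 0\<close> q by (intro Suc.hyps(1)) auto
  moreover have "cstar_invertible (poly_eval a [:- z, 1:])"
    using Suc.prems(2) z invertible_minus[of "scaleC z 1 - a"]
    by (force simp: spectrum_iff scaleC_minus_left)
  ultimately show ?case unfolding q poly_eval_mult by (intro invertible_mult)
qed

lemma poly_in_spectrum:
  assumes "z \<in> cstar_spectrum a"
  shows "poly p z \<in> cstar_spectrum (poly_eval a p)"
  unfolding spectrum_iff
proof
  assume inv: "cstar_invertible (scaleC (poly p z) 1 - poly_eval a p)"
  have "poly ([:poly p z:] - p) z = 0" by simp
  then obtain q where q: "[:poly p z:] - p = [:- z, 1:] * q" using poly_eq_0_iff_dvd by (metis dvdE)
  have "scaleC (poly p z) 1 - poly_eval a p = poly_eval a ([:poly p z:] - p)"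
    by (simp add: poly_eval_diff)
  also have "\<dots> = poly_eval a [:- z, 1:] * poly_eval a q" unfolding q by (rule poly_eval_mult)
  finally have "cstar_invertible (poly_eval a [:- z, 1:] * poly_eval a q)" using inv by simp
  moreover have "poly_eval a [:- z, 1:] * poly_eval a q = poly_eval a q * poly_eval a [:- z, 1:]"
    by (metis poly_eval_mult mult.commute)
  ultimately have "cstar_invertible (poly_eval a [:- z, 1:])" by (metis invertible_factor)
  then have "cstar_invertible (- (scaleC z 1 - a))" by (simp add: scaleC_minus_left)
  then show False using assms by (simp add: spectrum_iff invertible_minus del: minus_diff_eq)
qed

lemma spectrum_nonempty:
  "star a = a \<Longrightarrow> cstar_spectrum (a::'a::cstar_algebra) \<noteq> {}"
  using norm_in_spectrum_selfadjoint[of a] by blast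

lemma spectrum_poly_eval:
  assumes a: "star a = a" and w: "w \<in> cstar_spectrum (poly_eval a p)"
  obtains z where "z \<in> cstar_spectrum a" "w = poly p z"
proof (rule ccontr)
  assume no: "\<not> thesis"
  have ne: "poly ([:w:] - p) z \<noteq> 0" if "z \<in> cstar_spectrum a" for z
    using no that \<open>\<And>z. z \<in> cstar_spectrum a \<Longrightarrow> w = poly p z \<Longrightarrow> thesis\<close> by auto
  moreover have "[:w:] - p \<noteq> 0" using ne spectrum_nonempty[OF a] by (metis ex_in_conv poly_0)
  ultimately have "cstar_invertible (poly_eval a ([:w:] - p))" by (intro poly_eval_invertible)
  then show False using w by (simp add: poly_eval_diff spectrum_iff)
qed

lemma cnj_spectrum_selfadjoint:
  "star a = a \<Longrightarrow> z \<in> cstar_spectrum (a::'a::cstar_algebra) \<Longrightarrow> cnj z = z"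
  using spectrum_selfadjoint_real[of a z] by (simp add: Reals_cnj_iff)

text \<open>
  For \<open>p(a)\<close>, which need not be self-adjoint, the C*-identity passes to the self-adjoint
  \<open>p(a)\<^sup>* p(a)\<close>, whose norm is attained on its spectrum \<open>\<bar>p\<bar>\<^sup>2\<close>.
\<close>

lemma norm_poly_eval_attained:
  fixes a :: "'a::cstar_algebra"
  assumes a: "star a = a"
  obtains z where "z \<in> cstar_spectrum a" "norm (poly_eval a p) = cmod (poly p z)"
proof -
  let ?q = "map_poly cnj p * p"
  have q: "poly_eval a ?q = star (poly_eval a p) * poly_eval a p"
    by (simp add: poly_eval_mult poly_eval_star[OF a])
  then have "star (poly_eval a ?q) = poly_eval a ?q" by (simp add: star_mult star_star)
  then obtain w where w: "w \<in> cstar_spectrum (poly_eval a ?q)" "cmod w = norm (poly_eval a ?q)"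
    using norm_in_spectrum_selfadjoint[of "poly_eval a ?q"] by (metis norm_minus_cancel norm_of_real abs_norm_cancel)
  obtain z where z: "z \<in> cstar_spectrum a" "w = poly ?q z"
    using spectrum_poly_eval[OF a w(1)] by blast
  have "poly (map_poly cnj p) z = cnj (poly p z)"
    using poly_cnj[of p z] cnj_spectrum_selfadjoint[OF a z(1)] by simp
  then have "cmod w = (cmod (poly p z))\<^sup>2"
    by (simp add: z(2) norm_mult power2_eq_square)
  then have "(norm (poly_eval a p))\<^sup>2 = (cmod (poly p z))\<^sup>2"
    using w(2) cstar_identity[of "poly_eval a p"] by (simp add: q)
  then have "norm (poly_eval a p) = cmod (poly p z)" by simp
  then show thesis using z(1) that by blast
qed

lemma poly_le_norm_poly_eval:
  "z \<in> cstar_spectrum a \<Longrightarrow> cmod (poly p z) \<le> norm (poly_eval a p)"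
  by (rule spectrum_norm_le[OF poly_in_spectrum])

section \<open>The continuous functional calculus of a self-adjoint element\<close>

text \<open>
  The element \<open>b\<close> is \<open>f(a)\<close>. As a relation it can be shown to respect the algebraic operations
  without choosing approximating polynomials, and it depends on \<open>f\<close> only through the values of
  \<open>f\<close> on the spectrum.
\<close>

definition calculus_value :: "'a::cstar_algebra \<Rightarrow> (complex \<Rightarrow> complex) \<Rightarrow> 'a \<Rightarrow> bool"
  where "calculus_value a f b \<longleftrightarrow>
    (\<exists>p. uniform_limit (cstar_spectrum a) (\<lambda>n z. poly (p n) z) f sequentially \<and>
      (\<lambda>n. poly_eval a (p n)) \<longlonglongrightarrow> b)"

lemma calculus_value_poly: "calculus_value a (poly p) (poly_eval a p)"
  unfolding calculus_value_def by (intro exI[of _ "\<lambda>_. p"]) (simp add: uniform_limit_const)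

lemma calculus_value_le_norm:
  assumes "calculus_value a f b" and z: "z \<in> cstar_spectrum a"
  shows "cmod (f z) \<le> norm b"
proof -
  obtain p where p: "uniform_limit (cstar_spectrum a) (\<lambda>n z. poly (p n) z) f sequentially"
    "(\<lambda>n. poly_eval a (p n)) \<longlonglongrightarrow> b"
    using assms(1) unfolding calculus_value_def by blast
  have "(\<lambda>n. cmod (poly (p n) z)) \<longlonglongrightarrow> cmod (f z)"
    by (intro tendsto_norm tendsto_uniform_limitI[OF p(1) z])
  moreover have "(\<lambda>n. norm (poly_eval a (p n))) \<longlonglongrightarrow> norm b" by (intro tendsto_norm p(2))
  ultimately show ?thesis
    using poly_le_norm_poly_eval[OF z] by (intro LIMSEQ_le) auto
qed

lemma norm_le_calculus_value:
  fixes a :: "'a::cstar_algebra"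
  assumes a: "star a = a" and "calculus_value a f b"
    and c: "\<And>z. z \<in> cstar_spectrum a \<Longrightarrow> cmod (f z) \<le> c"
  shows "norm b \<le> c"
proof (rule field_le_epsilon)
  fix e :: real assume e: "e > 0"
  obtain p where p: "uniform_limit (cstar_spectrum a) (\<lambda>n z. poly (p n) z) f sequentially"
    "(\<lambda>n. poly_eval a (p n)) \<longlonglongrightarrow> b"
    using assms(2) unfolding calculus_value_def by blast
  have "\<forall>\<^sub>F n in sequentially. \<forall>z\<in>cstar_spectrum a. dist (poly (p n) z) (f z) < e"
    using p(1) e by (rule uniform_limitD)
  then have "\<forall>\<^sub>F n in sequentially. norm (poly_eval a (p n)) \<le> c + e"
  proof (rule eventually_mono)
    fix n assume n: "\<forall>z\<in>cstar_spectrum a. dist (poly (p n) z) (f z) < e"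
    obtain z where z: "z \<in> cstar_spectrum a" "norm (poly_eval a (p n)) = cmod (poly (p n) z)"
      by (rule norm_poly_eval_attained[OF a])
    have "cmod (poly (p n) z) \<le> cmod (f z) + dist (poly (p n) z) (f z)"
      using norm_triangle_ineq[of "f z" "poly (p n) z - f z"] by (simp add: dist_norm)
    then show "norm (poly_eval a (p n)) \<le> c + e" using n c[OF z(1)] z by fastforce
  qed
  then show "norm b \<le> c + e"
    by (intro tendsto_upperbound[OF tendsto_norm[OF p(2)]]) auto
qed

lemma norm_calculus_value:
  fixes a :: "'a::cstar_algebra"
  assumes a: "star a = a" and b: "calculus_value a f b"
  shows "norm b = (SUP z \<in> cstar_spectrum a. cmod (f z))"
proof (rule antisym)
  have "bdd_above ((\<lambda>z. cmod (f z)) ` cstar_spectrum a)"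
    using calculus_value_le_norm[OF b] by (intro bdd_aboveI2)
  then show "norm b \<le> (SUP z \<in> cstar_spectrum a. cmod (f z))"
    by (intro norm_le_calculus_value[OF a b] cSUP_upper)
  show "(SUP z \<in> cstar_spectrum a. cmod (f z)) \<le> norm b"
    using calculus_value_le_norm[OF b] by (intro cSUP_least spectrum_nonempty[OF a])
qed

lemma calculus_value_cong:
  assumes "calculus_value a f b" "\<And>z. z \<in> cstar_spectrum a \<Longrightarrow> f z = g z"
  shows "calculus_value a g b"
proof -
  obtain p where p: "uniform_limit (cstar_spectrum a) (\<lambda>n z. poly (p n) z) f sequentially"
    "(\<lambda>n. poly_eval a (p n)) \<longlonglongrightarrow> b"
    using assms(1) unfolding calculus_value_def by blast
  from p(1) have "uniform_limit (cstar_spectrum a) (\<lambda>n z. poly (p n) z) g sequentially"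
    by (rule uniform_limit_cong'[THEN iffD1, rotated 2]) (simp_all add: assms(2))
  then show ?thesis using p(2) unfolding calculus_value_def by blast
qed

lemma calculus_value_add:
  assumes "calculus_value a f b" "calculus_value a g c"
  shows "calculus_value a (\<lambda>z. f z + g z) (b + c)"
proof -
  obtain p q where "uniform_limit (cstar_spectrum a) (\<lambda>n z. poly (p n) z) f sequentially"
    "(\<lambda>n. poly_eval a (p n)) \<longlonglongrightarrow> b"
    "uniform_limit (cstar_spectrum a) (\<lambda>n z. poly (q n) z) g sequentially"
    "(\<lambda>n. poly_eval a (q n)) \<longlonglongrightarrow> c"
    using assms unfolding calculus_value_def by blast
  then show ?thesis
    unfolding calculus_value_def
    by (intro exI[of _ "\<lambda>n. p n + q n"])
      (simp add: poly_add[abs_def] poly_eval_add uniform_limit_add tendsto_add)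
qed

lemma calculus_value_mult:
  assumes b: "calculus_value a f b" and c: "calculus_value a g c"
  shows "calculus_value a (\<lambda>z. f z * g z) (b * c)"
proof -
  obtain p q where *: "uniform_limit (cstar_spectrum a) (\<lambda>n z. poly (p n) z) f sequentially"
    "(\<lambda>n. poly_eval a (p n)) \<longlonglongrightarrow> b"
    "uniform_limit (cstar_spectrum a) (\<lambda>n z. poly (q n) z) g sequentially"
    "(\<lambda>n. poly_eval a (q n)) \<longlonglongrightarrow> c"
    using assms unfolding calculus_value_def by blast
  have "bounded (f ` cstar_spectrum a)" "bounded (g ` cstar_spectrum a)"
    using calculus_value_le_norm[OF b] calculus_value_le_norm[OF c] by (auto simp: bounded_iff)
  then have "uniform_limit (cstar_spectrum a) (\<lambda>n z. poly (p n) z * poly (q n) z)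
      (\<lambda>z. f z * g z) sequentially"
    by (intro uniform_lim_mult *)
  then show ?thesis
    unfolding calculus_value_def
    using tendsto_mult[OF *(2,4)] 
    by (intro exI[of _ "\<lambda>n. p n * q n"]) (simp add: poly_mult[abs_def] poly_eval_mult)
qed

lemma calculus_value_scaleC:
  assumes "calculus_value a f b"
  shows "calculus_value a (\<lambda>z. c * f z) (scaleC c b)"
proof -
  have "poly_eval a [:c:] * b = scaleC c b" by (simp add: mult_scaleC_left)
  then show ?thesis
    using calculus_value_mult[OF calculus_value_poly[of a "[:c:]"] assms] by simp
qed

lemma calculus_value_diff:
  assumes "calculus_value a f b" "calculus_value a g c"
  shows "calculus_value a (\<lambda>z. f z - g z) (b - c)"
  using calculus_value_add[OF assms(1) calculus_value_scaleC[OF assms(2), of "- 1"]]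
  by (simp add: scaleC_minus_left)

lemma calculus_value_star:
  fixes a :: "'a::cstar_algebra"
  assumes a: "star a = a" and "calculus_value a f b"
  shows "calculus_value a (\<lambda>z. cnj (f z)) (star b)"
proof -
  obtain p where p: "uniform_limit (cstar_spectrum a) (\<lambda>n z. poly (p n) z) f sequentially"
    "(\<lambda>n. poly_eval a (p n)) \<longlonglongrightarrow> b"
    using assms(2) unfolding calculus_value_def by blast
  have "uniform_limit (cstar_spectrum a) (\<lambda>n z. cnj (poly (p n) z)) (\<lambda>z. cnj (f z)) sequentially"
    by (rule bounded_linear.uniform_limit[OF bounded_linear_cnj p(1)])
  moreover have "poly (map_poly cnj (p n)) z = cnj (poly (p n) z)"
    if "z \<in> cstar_spectrum a" for n z
    using poly_cnj[of "p n" z] cnj_spectrum_selfadjoint[OF a that] by simp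
  ultimately have "uniform_limit (cstar_spectrum a) (\<lambda>n z. poly (map_poly cnj (p n)) z)
      (\<lambda>z. cnj (f z)) sequentially"
    by (simp add: uniform_limit_iff)
  moreover have "(\<lambda>n. poly_eval a (map_poly cnj (p n))) \<longlonglongrightarrow> star b"
    using bounded_linear.tendsto[OF bounded_linear_star p(2)] by (simp add: poly_eval_star[OF a])
  ultimately show ?thesis
    unfolding calculus_value_def by (intro exI[of _ "\<lambda>n. map_poly cnj (p n)"] conjI)
qed

lemma calculus_value_unique:
  fixes a :: "'a::cstar_algebra"
  assumes a: "star a = a" and "calculus_value a f b" "calculus_value a g c"
    and "\<And>z. z \<in> cstar_spectrum a \<Longrightarrow> f z = g z"
  shows "b = c"
  using norm_le_calculus_value[OF a calculus_value_diff[OF assms(2,3)], of 0] assms(4) by simp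

lemma real_polynomial_approximation:
  fixes h :: "complex \<Rightarrow> real"
  assumes S: "compact S" "S \<subseteq> \<real>" and h: "continuous_on S h" and e: "e > 0"
  obtains p where "\<And>z. z \<in> S \<Longrightarrow> cmod (poly p z - complex_of_real (h z)) < e"
proof -
  have real: "complex_of_real (Re z) = z" if "z \<in> S" for z
    using S(2) that by (auto elim!: Reals_cases)
  have "compact (Re ` S)"
    by (intro compact_continuous_image S continuous_intros)
  moreover have "continuous_on (Re ` S) (\<lambda>r. h (complex_of_real r))"
    using real by (intro continuous_on_compose2[OF h] continuous_intros) auto
  ultimately obtain g where g: "real_polynomial_function g"
    "\<And>r. r \<in> Re ` S \<Longrightarrow> \<bar>h (complex_of_real r) - g r\<bar> < e"
    using Stone_Weierstrass_real_polynomial_function[OF _ _ e] by blast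
  obtain c n where gc: "g = (\<lambda>x. \<Sum>i\<le>n. c i * x ^ i)"
    using g(1) unfolding real_polynomial_function_iff_sum by blast
  define p where "p = (\<Sum>i\<le>n. monom (complex_of_real (c i)) i)"
  have "cmod (poly p z - complex_of_real (h z)) < e" if z: "z \<in> S" for z
  proof -
    have "poly p (complex_of_real r) = complex_of_real (g r)" for r
      by (simp add: p_def gc poly_sum poly_monom)
    from this[of "Re z"] have "poly p z - complex_of_real (h z) = complex_of_real (g (Re z) - h z)"
      using real[OF z] by simp
    then have "cmod (poly p z - complex_of_real (h z)) = \<bar>g (Re z) - h z\<bar>"
      by (simp only: norm_of_real)
    then show ?thesis using g(2)[of "Re z"] z real[OF z] by (simp add: abs_minus_commute)
  qed
  then show thesis by (rule that)
qed

lemma complex_polynomial_approximation: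
  fixes f :: "complex \<Rightarrow> complex"
  assumes S: "compact S" "S \<subseteq> \<real>" and f: "continuous_on S f" and e: "e > 0"
  obtains p where "\<And>z. z \<in> S \<Longrightarrow> cmod (poly p z - f z) < e"
proof -
  obtain p where p: "\<And>z. z \<in> S \<Longrightarrow> cmod (poly p z - complex_of_real (Re (f z))) < e / 2"
    by (rule real_polynomial_approximation[OF S continuous_on_Re[OF f], of "e / 2"]) (use e in auto)
  obtain q where q: "\<And>z. z \<in> S \<Longrightarrow> cmod (poly q z - complex_of_real (Im (f z))) < e / 2"
    by (rule real_polynomial_approximation[OF S continuous_on_Im[OF f], of "e / 2"]) (use e in auto)
  have "cmod (poly (p + smult \<i> q) z - f z) < e" if z: "z \<in> S" for z
  proof -
    have "poly (p + smult \<i> q) z - f z =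
        (poly p z - complex_of_real (Re (f z))) + \<i> * (poly q z - complex_of_real (Im (f z)))"
      using complex_eq[of "f z"] by (simp add: algebra_simps)
    then have "cmod (poly (p + smult \<i> q) z - f z) \<le>
        cmod (poly p z - complex_of_real (Re (f z))) + cmod (poly q z - complex_of_real (Im (f z)))"
      by (metis norm_triangle_ineq norm_mult norm_ii mult_1)
    then show ?thesis using p[OF z] q[OF z] by linarith
  qed
  then show thesis by (rule that)
qed

lemma calculus_value_exists:
  fixes a :: "'a::cstar_algebra"
  assumes a: "star a = a" and f: "continuous_on (cstar_spectrum a) f"
  obtains b where "calculus_value a f b"
proof -
  have real: "cstar_spectrum a \<subseteq> \<real>" using spectrum_selfadjoint_real[OF a] by blast
  have "\<exists>p. \<forall>z\<in>cstar_spectrum a. cmod (poly p z - f z) < 1 / real (Suc n)" for n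
    using complex_polynomial_approximation[OF compact_spectrum real f, of "1 / real (Suc n)"]
    by (metis of_nat_0_less_iff zero_less_Suc zero_less_divide_1_iff)
  then obtain p where p: "\<And>n z. z \<in> cstar_spectrum a \<Longrightarrow> cmod (poly (p n) z - f z) < 1 / real (Suc n)"
    by metis
  have lim: "uniform_limit (cstar_spectrum a) (\<lambda>n z. poly (p n) z) f sequentially"
  proof (rule uniform_limitI)
    fix e :: real assume "e > 0"
    then obtain N where N: "1 / real (Suc N) < e" using nat_approx_posE by blast
    have "1 / real (Suc n) \<le> 1 / real (Suc N)" if "n \<ge> N" for n
      using that by (simp add: frac_le)
    then show "\<forall>\<^sub>F n in sequentially. \<forall>z\<in>cstar_spectrum a. dist (poly (p n) z) (f z) < e"
      using p N unfolding eventually_sequentially dist_norm by (meson less_le_trans less_trans)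
  qed
  have "Cauchy (\<lambda>n. poly_eval a (p n))"
  proof (rule CauchyI)
    fix e :: real assume "e > 0"
    then obtain N where N: "\<And>n z. n \<ge> N \<Longrightarrow> z \<in> cstar_spectrum a \<Longrightarrow> dist (poly (p n) z) (f z) < e / 2"
      using uniform_limitD[OF lim, of "e / 2"] unfolding eventually_sequentially by auto
    have "norm (poly_eval a (p m) - poly_eval a (p n)) < e" if mn: "m \<ge> N" "n \<ge> N" for m n
    proof -
      obtain z where z: "z \<in> cstar_spectrum a"
        "norm (poly_eval a (p m - p n)) = cmod (poly (p m - p n) z)"
        by (rule norm_poly_eval_attained[OF a])
      have "dist (poly (p m) z) (poly (p n) z) < e"
        using N[OF mn(1) z(1)] N[OF mn(2) z(1)] by (rule dist_triangle_half_l)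
      then show ?thesis using z(2) by (simp add: poly_eval_diff dist_norm)
    qed
    then show "\<exists>M. \<forall>m\<ge>M. \<forall>n\<ge>M. norm (poly_eval a (p m) - poly_eval a (p n)) < e" by blast
  qed
  then obtain b where "(\<lambda>n. poly_eval a (p n)) \<longlonglongrightarrow> b"
    using Cauchy_convergent_iff convergent_def by blast
  then show thesis using lim that unfolding calculus_value_def by blast
qed

text \<open>
  Only the values of \<open>\<Phi>\<close> at continuous functions matter; at other functions there may be no
  calculus value.
\<close>

lemma functional_calculus_exists:
  fixes a :: "'a::cstar_algebra"
  assumes a: "star a = a"
  obtains \<Phi> where "is_functional_calculus a \<Phi>"
proof -
  define \<Phi> where "\<Phi> f = (THE b. calculus_value a f b)" for f
  have eq: "\<Phi> f = b" if "calculus_value a f b" for f b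
    unfolding \<Phi>_def using that calculus_value_unique[OF a] by blast
  have val: "calculus_value a f (\<Phi> f)" if "continuous_on (cstar_spectrum a) f" for f
    using calculus_value_exists[OF a that] eq by metis
  have "is_functional_calculus a \<Phi>"
    unfolding is_functional_calculus_def
  proof (intro conjI allI impI)
    fix f g :: "complex \<Rightarrow> complex"
    assume f: "continuous_on (cstar_spectrum a) f" and g: "continuous_on (cstar_spectrum a) g"
    note fg = val[OF f] val[OF g]
    show "\<Phi> (\<lambda>z. f z + g z) = \<Phi> f + \<Phi> g" by (rule eq[OF calculus_value_add[OF fg]])
    show "\<Phi> (\<lambda>z. f z * g z) = \<Phi> f * \<Phi> g" by (rule eq[OF calculus_value_mult[OF fg]])
  next
    fix f :: "complex \<Rightarrow> complex" assume "continuous_on (cstar_spectrum a) f"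
    note f = val[OF this]
    show "\<Phi> (\<lambda>z. c * f z) = scaleC c (\<Phi> f)" for c by (rule eq[OF calculus_value_scaleC[OF f]])
    show "\<Phi> (\<lambda>z. cnj (f z)) = star (\<Phi> f)" by (rule eq[OF calculus_value_star[OF a f]])
    show "norm (\<Phi> f) = (SUP z\<in>cstar_spectrum a. cmod (f z))" by (rule norm_calculus_value[OF a f])
  next
    have "poly [:1:] = (\<lambda>z::complex. 1)" "poly_eval a [:1:] = 1" by (auto simp: fun_eq_iff)
    then show "\<Phi> (\<lambda>z. 1) = 1" using eq[OF calculus_value_poly[of a "[:1:]"]] by simp
    have "poly [:0, 1:] = (\<lambda>z::complex. z)" "poly_eval a [:0, 1:] = a" by (auto simp: fun_eq_iff)
    then show "\<Phi> (\<lambda>z. z) = a" using eq[OF calculus_value_poly[of a "[:0, 1:]"]] by simp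
  qed
  then show thesis by (rule that)
qed

text \<open>
  Any functional calculus agrees with polynomial evaluation on polynomials, since they are
  generated by the constants and the identity, and hence with \<open>calculus_value\<close> by isometry.
\<close>

lemma functional_calculus_value:
  fixes a :: "'a::cstar_algebra"
  assumes a: "star a = a" and \<Phi>: "is_functional_calculus a \<Phi>"
    and f: "continuous_on (cstar_spectrum a) f"
  shows "calculus_value a f (\<Phi> f)"
proof -
  note D = \<Phi>[unfolded is_functional_calculus_def]
  have add: "\<Phi> (\<lambda>z. g z + h z) = \<Phi> g + \<Phi> h" and mult: "\<Phi> (\<lambda>z. g z * h z) = \<Phi> g * \<Phi> h"
    if "continuous_on (cstar_spectrum a) g" "continuous_on (cstar_spectrum a) h" for g h
    using D[THEN conjunct1] that by simp_all
  have scale: "\<Phi> (\<lambda>z. c * g z) = scaleC c (\<Phi> g)"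
    and norm: "norm (\<Phi> g) = (SUP z\<in>cstar_spectrum a. cmod (g z))"
    if "continuous_on (cstar_spectrum a) g" for g c
    using D[THEN conjunct2, THEN conjunct1] that by simp_all
  have one: "\<Phi> (\<lambda>z. 1) = 1" and ident: "\<Phi> (\<lambda>z. z) = a"
    using D[THEN conjunct2, THEN conjunct2] by simp_all
  have const: "\<Phi> (\<lambda>z. c) = scaleC c 1" for c
    using scale[of "\<lambda>z. 1" c] one by simp
  have cont_poly: "continuous_on S (poly p)" for S and p :: "complex poly"
    by (intro continuous_intros)
  have poly: "\<Phi> (poly p) = poly_eval a p" for p
  proof (induction p)
    case 0
    then show ?case using const[of 0] by simp
  next
    case (pCons c p)
    have "\<Phi> (\<lambda>z. c + z * poly p z) = \<Phi> (\<lambda>z. c) + \<Phi> (\<lambda>z. z * poly p z)"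
      by (intro add continuous_intros)
    also have "\<Phi> (\<lambda>z. z * poly p z) = a * poly_eval a p"
      using mult[OF continuous_on_id cont_poly] ident pCons.IH by simp
    finally show ?case using const[of c] by (simp add: poly_pCons[abs_def])
  qed
  obtain b where b: "calculus_value a f b" using calculus_value_exists[OF a f] by blast
  obtain p where p: "uniform_limit (cstar_spectrum a) (\<lambda>n z. poly (p n) z) f sequentially"
    "(\<lambda>n. poly_eval a (p n)) \<longlonglongrightarrow> b"
    using b unfolding calculus_value_def by blast
  have "(\<lambda>n. poly_eval a (p n)) \<longlonglongrightarrow> \<Phi> f"
  proof (rule LIMSEQ_I)
    fix e :: real assume e: "e > 0"
    then obtain N where N: "\<And>n z. n \<ge> N \<Longrightarrow> z \<in> cstar_spectrum a \<Longrightarrow> dist (poly (p n) z) (f z) < e / 2"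
      using uniform_limitD[OF p(1), of "e / 2"] unfolding eventually_sequentially by auto
    have "norm (poly_eval a (p n) - \<Phi> f) < e" if n: "n \<ge> N" for n
    proof -
      have "poly_eval a (p n) - \<Phi> f = \<Phi> (poly (p n)) + \<Phi> (\<lambda>z. - 1 * f z)"
        using scale[OF f, of "- 1"] poly[of "p n"] by (simp add: scaleC_minus_left)
      also have "\<dots> = \<Phi> (\<lambda>z. poly (p n) z + - 1 * f z)"
        by (intro add[symmetric] cont_poly continuous_intros f)
      finally have "norm (poly_eval a (p n) - \<Phi> f) = (SUP z\<in>cstar_spectrum a. cmod (poly (p n) z + - 1 * f z))"
        using norm[of "\<lambda>z. poly (p n) z + - 1 * f z"] f by (simp add: continuous_intros)
      also have "\<dots> \<le> e / 2"
        using N[OF n] by (intro cSUP_least spectrum_nonempty[OF a]) (simp add: dist_norm less_imp_le)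
      finally show ?thesis using e by simp
    qed
    then show "\<exists>no. \<forall>n\<ge>no. norm (poly_eval a (p n) - \<Phi> f) < e" by blast
  qed
  then show ?thesis using p(1) unfolding calculus_value_def by blast
qed

text \<open>So all functional calculi have the same value at \<open>f\<close>, and the description is proper.\<close>

lemma cfc_value:
  fixes a :: "'a::cstar_algebra"
  assumes a: "star a = a" and f: "continuous_on (cstar_spectrum a) f"
  shows "calculus_value a f (cfc a f)"
proof -
  obtain \<Phi> where \<Phi>: "is_functional_calculus a \<Phi>" by (rule functional_calculus_exists[OF a])
  have "cfc a f = \<Phi> f"
    unfolding cfc_def
  proof (rule the_equality)
    fix b assume "\<exists>\<Psi>. is_functional_calculus a \<Psi> \<and> \<Psi> f = b"
    then obtain \<Psi> where "is_functional_calculus a \<Psi>" "\<Psi> f = b" by blast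
    then show "b = \<Phi> f"
      using calculus_value_unique[OF a functional_calculus_value[OF a _ f]
          functional_calculus_value[OF a \<Phi> f]] by blast
  qed (use \<Phi> in blast)
  then show ?thesis using functional_calculus_value[OF a \<Phi> f] by simp
qed

section \<open>Powers of a positive element\<close>

lemma continuous_on_spectrum_powr:
  fixes a :: "'a::cstar_algebra"
  assumes a: "a \<in> positive_elements" and \<alpha>: "\<alpha> > 0 \<or> cstar_invertible a"
  shows "continuous_on (cstar_spectrum a) (\<lambda>z. complex_of_real (Re z powr \<alpha>))"
proof (intro continuous_on_of_real continuous_on_powr' continuous_intros ballI conjI impI)
  fix z assume z: "z \<in> cstar_spectrum a"
  show "0 \<le> Re z" using a z by (simp add: positive_elements_def)
  assume "Re z = 0"
  then have "z = 0" using a z by (auto simp: positive_elements_def complex_is_Real_iff complex_eq_iff)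
  then show "0 < \<alpha>" using \<alpha> z by (simp add: zero_in_spectrum)
qed

text \<open>Half the exponent exhibits the power as a square.\<close>

lemma cstar_powr_positive:
  fixes a :: "'a::cstar_algebra"
  assumes a: "a \<in> positive_elements" and \<alpha>: "\<alpha> > 0"
  shows "cstar_powr a \<alpha> \<in> positive_elements"
proof -
  have sa: "star a = a" by (rule positive_selfadjoint[OF a])
  define h where "h z = complex_of_real (Re z powr (\<alpha> / 2))" for z
  have "continuous_on (cstar_spectrum a) h"
    unfolding h_def by (rule continuous_on_spectrum_powr[OF a]) (use \<alpha> in simp)
  then obtain b where b: "calculus_value a h b" by (rule calculus_value_exists[OF sa])
  have "star b = b"
    using calculus_value_unique[OF sa calculus_value_star[OF sa b] b] by (simp add: h_def)
  moreover have "cstar_powr a \<alpha> = b * b"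
    unfolding cstar_powr_def
  proof (rule calculus_value_unique[OF sa cfc_value[OF sa] calculus_value_mult[OF b b]])
    show "complex_of_real (Re z powr \<alpha>) = h z * h z" for z
      unfolding h_def of_real_mult[symmetric] powr_add[symmetric] by simp
  qed (use continuous_on_spectrum_powr[OF a] \<alpha> in blast)
  ultimately show ?thesis using positive_square by metis
qed

text \<open>
  The spectrum of an invertible element avoids \<open>0\<close>, where negative powers are discontinuous, so the
  power with exponent \<open>- \<alpha>\<close> is an inverse.
\<close>

lemma cstar_powr_invertible:
  fixes a :: "'a::cstar_algebra"
  assumes a: "a \<in> positive_elements" and inv: "cstar_invertible a"
  shows "cstar_invertible (cstar_powr a \<alpha>)"
proof -
  have sa: "star a = a" by (rule positive_selfadjoint[OF a])
  have v: "calculus_value a (\<lambda>z. complex_of_real (Re z powr \<beta>)) (cstar_powr a \<beta>)" for \<beta>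
    unfolding cstar_powr_def using inv by (intro cfc_value sa continuous_on_spectrum_powr a) simp
  have one: "calculus_value a (\<lambda>z. 1) 1"
    using calculus_value_cong[OF calculus_value_poly[of a "[:1:]"]] by simp
  have nz: "Re z \<noteq> 0" if "z \<in> cstar_spectrum a" for z
  proof
    assume "Re z = 0"
    then have "z = 0"
      using spectrum_selfadjoint_real[OF sa that] by (simp add: complex_is_Real_iff complex_eq_iff)
    then show False using that inv by (simp add: zero_in_spectrum)
  qed
  have "cstar_powr a \<beta> * cstar_powr a (- \<beta>) = 1" for \<beta>
    by (rule calculus_value_unique[OF sa calculus_value_mult[OF v v] one])
      (use nz in \<open>simp add: powr_add[symmetric] flip: of_real_mult\<close>)
  from this[of \<alpha>] this[of "- \<alpha>"] show ?thesis unfolding cstar_invertible_def by auto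
qed

lemma cstar_powr_one:
  fixes a :: "'a::cstar_algebra"
  assumes a: "a \<in> positive_elements"
  shows "cstar_powr a 1 = a"
proof -
  have sa: "star a = a" by (rule positive_selfadjoint[OF a])
  have ident: "calculus_value a (poly [:0, 1:]) a"
    using calculus_value_poly[of a "[:0, 1:]"] by simp
  have powr: "calculus_value a (\<lambda>z. complex_of_real (Re z powr 1)) (cstar_powr a 1)"
    unfolding cstar_powr_def by (intro cfc_value sa continuous_on_spectrum_powr a) simp
  show ?thesis
  proof (rule calculus_value_unique[OF sa powr ident])
    fix z assume "z \<in> cstar_spectrum a"
    then show "complex_of_real (Re z powr 1) = poly [:0, 1:] z"
      using a by (auto simp: positive_elements_def complex_is_Real_iff complex_eq_iff)
  qed
qed

section \<open>Invertibility and equivalence of norms\<close>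

theorem corollary2:
  fixes a :: "'a::cstar_algebra"
  assumes "a \<in> positive_elements"
  shows "(cstar_invertible a \<longleftrightarrow> equivalent_norms_on hermitian_dual (r_seminorm a) onorm) \<and>
    (cstar_invertible a \<longleftrightarrow>
      (\<forall>\<alpha>::real. 0 < \<alpha> \<longrightarrow>
        equivalent_norms_on hermitian_dual (r_seminorm (cstar_powr a \<alpha>)) onorm))"
proof (intro conjI iffI allI impI)
  show "equivalent_norms_on hermitian_dual (r_seminorm a) onorm" if "cstar_invertible a"
    by (rule invertible_imp_equivalent_norms[OF assms that])
  show inv: "cstar_invertible a" if "equivalent_norms_on hermitian_dual (r_seminorm a) onorm"
    using norm_r_seminorm_imp_invertible[OF assms] that by (simp add: equivalent_norms_on_def)
  show "equivalent_norms_on hermitian_dual (r_seminorm (cstar_powr a \<alpha>)) onorm"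
    if "cstar_invertible a" "0 < \<alpha>" for \<alpha>
    using that assms
    by (intro invertible_imp_equivalent_norms cstar_powr_positive cstar_powr_invertible)
  show "cstar_invertible a"
    if "\<forall>\<alpha>>0. equivalent_norms_on hermitian_dual (r_seminorm (cstar_powr a \<alpha>)) onorm"
    using that[rule_format, of 1] inv by (simp add: cstar_powr_one[OF assms])
qed

end
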